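(* Let $\omega\in\mathbb{R}\setminus\{0\}$ be such that $\sigma=\jmath\omega$ is not an eigenvalue of $\mathcal{H}$. If $\phi$ is given by $$\phi(\theta)=\left(\sum_{l=0}^{N}q_l\,T_l\!\left(\frac{\theta}{\tau_K}\right)\right)e^{\jmath\omega\theta}+\left(\sum_{l=0}^{N}\overline{q_l}\,T_l\!\left(\frac{\theta}{\tau_K}\right)\right)e^{-\jmath\omega\theta},\qquad\theta\in[-\tau_K,\tau_K],$$ with $q_0,\dots,q_N\in\mathbb{C}^{2n}$, then $\varphi:=\mathcal{R}_{\sigma}^{-1}\phi$ is given by $$\varphi(\theta)=\left(\sum_{l=0}^{N+1}v_l\,T_l\!\left(\frac{\theta}{\tau_K}\right)\right)e^{\jmath\omega\theta}+\left(\sum_{l=0}^{N+1}\overline{v_l}\,T_l\!\left(\frac{\theta}{\tau_K}\right)\right)e^{-\jmath\omega\theta},$$ in which the coefficient vectors $v_1,\dots,v_{N+1}\in\mathbb{C}^{2n}$ are given by $$\begin{bmatrix}v_1&\cdots&v_{N+1}\end{bmatrix}\left(2\jmath\omega\tau_K\,A_N+B_N\right)=\tau_K^2\begin{bmatrix}q_0&\cdots&q_N\end{bmatrix}Z_N,$$ with $A_N,B_N,Z_N\in\mathbb{R}^{(N+1)\times(N+1)}$ the banded matrices defined in the context, and $v_0\in\mathbb{C}^{2n}$ can be found by solving the system $$\begin{aligned}\jmath\omega\,M(\jmath\omega)\,v_0=\;&(H_0-\jmath\omega I_{2n})\sum_{l=1}^{N+1}\left(\Re(v_l)\frac{T_l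'(0)}{\tau_K}+\jmath\omega\,v_l\,T_l(0)\right)\\&+\sum_{k=1}^K\Bigg[H_k\sum_{l=1}^{N+1}\left(\frac{\Re\big(v_le^{\jmath\omega\tau_k}\big)}{\tau_K}T_l'\!\left(\tfrac{\tau_k}{\tau_K}\right)+\jmath\omega\,v_l\,T_l\!\left(\tfrac{\tau_k}{\tau_K}\right)e^{\jmath\omega\tau_k}\right)\\&\qquad\quad+H_{-k}\sum_{l=1}^{N+1}\left(\frac{\Re\big(v_le^{-\jmath\omega\tau_k}\big)}{\tau_K}T_l'\!\left(-\tfrac{\tau_k}{\tau_K}\right)+\jmath\omega\,v_l\,T_l\!\left(-\tfrac{\tau_k}{\tau_K}\right)e^{-\jmath\omega\tau_k}\right)\Bigg]\\&-\sum_{l=0}^{N}\Re(q_l)\,T_l(0).\end{aligned}$$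
   Context: $\jmath$ is the imaginary unit; $\Re$ and the overline denote the entrywise real part and complex conjugate. Let $n,K$ be positive integers, $0<\tau_1<\dots<\tau_K<\infty$, and let $H_0,H_1,H_{-1},\dots,H_K,H_{-K}\in\mathbb{R}^{2n\times 2n}$. Let $J=\begin{bmatrix}0&I_n\\-I_n&0\end{bmatrix}$. Standing assumption: $(JH_0)^{\top}=JH_0$ and $(JH_{-k})^{\top}=JH_k$ for $k=1,\dots,K$. The characteristic matrix is $M(\lambda)=\lambda I_{2n}-H_0-\sum_{k=1}^K(H_{-k}e^{-\lambda\tau_k}+H_ke^{\lambda\tau_k})$. Let $X=C([-\tau_K,\tau_K],\mathbb{C}^{2n})$. The operator $\mathcal{H}:D(\mathcal{H})\subseteq X\to X$ is $\mathcal{H}\varphi=\varphi'$ with $$D(\mathcal{H})=\Big\{\varphi\in X:\varphi'\in X,\ \varphi'(0)=H_0\varphi(0)+\sum_{k=1}^K\big(H_{-k}\varphi(-\tau_k)+H_k\varphi(\tau_k)\big)\Big\}.$$ For $\sigma\in\mathbb{C}$, let $\mathcal{R}_{\sigma}=(\mathcal{H}-\sigma\mathcal{I}_X)(\mathcal{H}+\sigma\mathcal{I}_X)$, i.e. $\mathcal{R}_{\sigma}\varphi=\varphi''-\sigma^2\varphi$ with domain $D(\mathcal{R}_{\sigma})$ consisting of all $\varphi\in X$ with $\varphi',\varphi''\in X$ satisfying $$\varphi'(0)=H_0\varphi(0)+\sum_{k=1}^K\big(H_{-k}\varphi(-\tau_k)+H_k\varphi(\tau_k)\big),\qquad \varphi''(0)=H_0\varphi'(0)+\sum_{k=1}^K\big(H_{-k}\varphi'(-\tau_k)+H_k\varphi'(\tau_k)\big).$$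 If $\sigma$ is not an eigenvalue of $\mathcal{H}$, then $M(\sigma)$ is nonsingular and $\mathcal{R}_{\sigma}:D(\mathcal{R}_\sigma)\to X$ is invertible. $T_l$ is the $l$th Chebyshev polynomial of the first kind, $T_l(\cos x)=\cos(lx)$; $T_l'$ is its derivative. $N\ge0$ is an integer. Matrices (all unlisted entries are zero). For $A_N$ and $B_N$, index rows by $l=1,\dots,N+1$ (row $l$ multiplies $v_l$) and columns by $j=2,\dots,N+2$: $(A_N)_{l,l+1}=\frac{1}{2(l+1)}$ for $l=1,\dots,N+1$ and $(A_N)_{l,l-1}=-\frac{1}{2(l-1)}$ for $l=3,\dots,N+1$; $(B_N)_{l,l}=1$ for $l=2,\dots,N+1$. (So $A_N$ has diagonal $\frac14,\frac16,\frac18,\dots,\frac1{2(N+2)}$ and second subdiagonal $-\frac14,\dots,-\frac1{2N}$, and $B_N$ has ones on the first subdiagonal.) For $Z_N$, index rows by $l=0,\dots,N$ (row $l$ multiplies $q_l$) and columns by $j=2,\dots,N+2$; its only nonzero entries are (for those row indices with $l\le N$): $(Z_N)_{0,2}=\frac14$; $(Z_N)_{1,3}=\frac1{24}$; $(Z_N)_{2,2}=-\frac16$, $(Z_N)_{2,4}=\frac1{48}$; and for $l\ge3$: $(Z_N)_{l,l+2}=\frac{1}{4(l+1)(l+2)}$, $(Z_N)_{l,l}=-\frac{1}{2(l-1)(l+1)}$, and, if $l\ge4$, $(Z_N)_{l,l-2}=\frac{1}{4(l-1)(l-2)}$. *)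

theory Defs
  imports
    "HOL-Analysis.Analysis"
    "HOL-Computational_Algebra.Polynomial"
begin

fun cheb :: "nat \<Rightarrow> real poly" where
  "cheb 0 = 1"
| "cheb (Suc 0) = [:0, 1:]"
| "cheb (Suc (Suc l)) = [:0, 2:] * cheb (Suc l) - cheb l"

lemma cheb_cos: "poly (cheb l) (cos x) = cos (real l * x)"
proof (induction l rule: cheb.induct)
  case (3 l)
  have "cos (real (Suc (Suc l)) * x) + cos (real l * x) = 2 * cos x * cos (real (Suc l) * x)"
    using cos_plus_cos[of "real (Suc (Suc l)) * x" "real l * x"]
    by (simp add: algebra_simps add_divide_distrib)
  with 3 show ?case by (simp add: algebra_simps)
qed simp_all

text \<open>The recursion defines exactly the polynomial given by T_l(cos x) = cos (l x).\<close>

lemma cheb_unique: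
  assumes "\<And>x. poly p (cos x) = cos (real l * x)"
  shows "p = cheb l"
proof -
  have "{-1..1} \<subseteq> {t. poly (p - cheb l) t = 0}"
  proof
    fix t :: real assume "t \<in> {-1..1}"
    then have "t = cos (arccos t)" by simp
    then show "t \<in> {t. poly (p - cheb l) t = 0}"
      using assms[of "arccos t"] cheb_cos[of l "arccos t"] by simp
  qed
  moreover have "infinite {-1..1::real}" by (simp add: infinite_Icc)
  ultimately have "infinite {t. poly (p - cheb l) t = 0}"
    using finite_subset by blast
  then have "p - cheb l = 0" using poly_roots_finite by blast
  then show ?thesis by simp
qed

definition cmat :: "real^'m^'k \<Rightarrow> complex^'m^'k" where
  "cmat = map_matrix complex_of_real"

definition vRe :: "complex^'m \<Rightarrow> complex^'m" where
  "vRe x = (\<chi> i. complex_of_real (Re (x $ i)))"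

definition vcnj :: "complex^'m \<Rightarrow> complex^'m" where
  "vcnj x = (\<chi> i. cnj (x $ i))"

text \<open>Dimension 2n is encoded by the index type \<open>'n + 'n\<close>, where n is the cardinality of \<open>'n\<close>.\<close>

definition sympJ :: "real^('n::finite + 'n)^('n + 'n)" where
  "sympJ = (\<chi> a b. case (a, b) of
       (Inl i, Inr j) \<Rightarrow> if i = j then 1 else 0
     | (Inr i, Inl j) \<Rightarrow> if i = j then -1 else 0
     | _ \<Rightarrow> 0)"

text \<open>The matrices H_k are indexed by integers k; only those with |k| at most K are used.
  The maximal delay is \<open>\<tau> K\<close>, and the delays are \<open>\<tau> 1, \<dots>, \<tau> K\<close>.\<close>

definition char_mat ::
  "(int \<Rightarrow> real^'m^'m) \<Rightarrow> (nat \<Rightarrow> real) \<Rightarrow> nat \<Rightarrow> complex \<Rightarrow> complex^'m^'m" where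
  "char_mat H \<tau> K z = mat z - cmat (H 0)
     - (\<Sum>k=1..K. map_matrix (\<lambda>h. h * exp (- z * complex_of_real (\<tau> k))) (cmat (H (- int k)))
               + map_matrix (\<lambda>h. h * exp (z * complex_of_real (\<tau> k))) (cmat (H (int k))))"

text \<open>Functions on \<open>[-T, T]\<close> are represented as extensional functions on that interval, so that
  HOL equality is equality on the interval. Derivatives are one-sided at the end points.\<close>

definition C_space :: "real \<Rightarrow> (real \<Rightarrow> complex^'m) set" where
  "C_space T = {\<phi> \<in> extensional {-T..T}. continuous_on {-T..T} \<phi>}"

definition D_op :: "real \<Rightarrow> (real \<Rightarrow> complex^'m) \<Rightarrow> (real \<Rightarrow> complex^'m)" where
  "D_op T \<phi> = restrict (\<lambda>\<theta>. vector_derivative \<phi> (at \<theta> within {-T..T})) {-T..T}"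

definition C1_space :: "real \<Rightarrow> (real \<Rightarrow> complex^'m) set" where
  "C1_space T = {\<phi> \<in> C_space T. \<phi> differentiable_on {-T..T} \<and> D_op T \<phi> \<in> C_space T}"

definition ham_bc ::
  "(int \<Rightarrow> real^'m^'m) \<Rightarrow> (nat \<Rightarrow> real) \<Rightarrow> nat \<Rightarrow> (real \<Rightarrow> complex^'m) \<Rightarrow> bool" where
  "ham_bc H \<tau> K \<phi> \<longleftrightarrow>
     D_op (\<tau> K) \<phi> 0 = cmat (H 0) *v \<phi> 0
       + (\<Sum>k=1..K. cmat (H (- int k)) *v \<phi> (- \<tau> k) + cmat (H (int k)) *v \<phi> (\<tau> k))"

definition ham_dom ::
  "(int \<Rightarrow> real^'m^'m) \<Rightarrow> (nat \<Rightarrow> real) \<Rightarrow> nat \<Rightarrow> (real \<Rightarrow> complex^'m) set" where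
  "ham_dom H \<tau> K = {\<phi> \<in> C1_space (\<tau> K). ham_bc H \<tau> K \<phi>}"

definition ham_eigenvalue ::
  "(int \<Rightarrow> real^'m^'m) \<Rightarrow> (nat \<Rightarrow> real) \<Rightarrow> nat \<Rightarrow> complex \<Rightarrow> bool" where
  "ham_eigenvalue H \<tau> K \<sigma> \<longleftrightarrow>
     (\<exists>\<phi> \<in> ham_dom H \<tau> K. (\<exists>\<theta>\<in>{-\<tau> K..\<tau> K}. \<phi> \<theta> \<noteq> 0) \<and>
        (\<forall>\<theta>\<in>{-\<tau> K..\<tau> K}. D_op (\<tau> K) \<phi> \<theta> = \<sigma> *s \<phi> \<theta>))"

definition R_dom ::
  "(int \<Rightarrow> real^'m^'m) \<Rightarrow> (nat \<Rightarrow> real) \<Rightarrow> nat \<Rightarrow> (real \<Rightarrow> complex^'m) set" where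
  "R_dom H \<tau> K = {\<phi> \<in> C1_space (\<tau> K). D_op (\<tau> K) \<phi> \<in> C1_space (\<tau> K) \<and>
     ham_bc H \<tau> K \<phi> \<and> ham_bc H \<tau> K (D_op (\<tau> K) \<phi>)}"

definition R_op :: "real \<Rightarrow> complex \<Rightarrow> (real \<Rightarrow> complex^'m) \<Rightarrow> (real \<Rightarrow> complex^'m)" where
  "R_op T \<sigma> \<phi> = restrict (\<lambda>\<theta>. D_op T (D_op T \<phi>) \<theta> - \<sigma>\<^sup>2 *s \<phi> \<theta>) {-T..T}"

text \<open>\<open>R_op\<close> with domain \<open>R_dom\<close> is the composition of the Hamiltonian operator shifted by
  \<open>-\<sigma>\<close> and by \<open>\<sigma>\<close>, with its natural domain.\<close>

definition ham_shift :: "real \<Rightarrow> complex \<Rightarrow> (real \<Rightarrow> complex^'m) \<Rightarrow> (real \<Rightarrow> complex^'m)" where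
  "ham_shift T \<sigma> \<phi> = restrict (\<lambda>\<theta>. D_op T \<phi> \<theta> - \<sigma> *s \<phi> \<theta>) {-T..T}"

lemma bounded_linear_vector_scalar_mult: "bounded_linear (\<lambda>x::complex^'m. c *s x)"
proof -
  have "linear (\<lambda>x::complex^'m. c *s x)"
    by (rule linearI) (simp_all add: vec_eq_iff algebra_simps)
  then show ?thesis by (simp add: linear_conv_bounded_linear)
qed

lemma C1_space_alt:
  assumes "T > 0"
  shows "\<phi> \<in> C1_space T \<and> D_op T \<phi> = \<psi> \<longleftrightarrow>
    \<phi> \<in> extensional {-T..T} \<and> \<psi> \<in> C_space T \<and>
    (\<forall>\<theta>\<in>{-T..T}. (\<phi> has_vector_derivative \<psi> \<theta>) (at \<theta> within {-T..T}))" (is "?L \<longleftrightarrow> ?R")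
proof
  assume ?L
  then show ?R
    by (auto simp: C1_space_def C_space_def D_op_def differentiable_on_def
        vector_derivative_works)
next
  assume R: ?R
  have eq: "vector_derivative \<phi> (at \<theta> within {-T..T}) = \<psi> \<theta>" if "\<theta> \<in> {-T..T}" for \<theta>
    using R that assms by (intro vector_derivative_within_closed_interval[of "-T" T]) auto
  have D: "D_op T \<phi> = \<psi>"
    unfolding D_op_def using R eq
    by (intro extensionalityI[where A = "{-T..T}"]) (auto simp: C_space_def)
  have "\<phi> differentiable_on {-T..T}"
    using R by (auto simp: differentiable_on_def intro: differentiableI_vector)
  then show ?L
    using R D by (auto simp: C1_space_def C_space_def differentiable_imp_continuous_on)
qed

lemma D_op_add_scaled:
  fixes c :: complex and \<phi> \<psi> :: "real \<Rightarrow> complex^'m"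
  assumes "T > 0" "\<phi> \<in> C1_space T" "\<psi> \<in> C1_space T"
  defines "\<rho> \<equiv> restrict (\<lambda>\<theta>. \<psi> \<theta> - c *s \<phi> \<theta>) {-T..T}"
  shows "\<rho> \<in> C1_space T \<and> D_op T \<rho> = restrict (\<lambda>\<theta>. D_op T \<psi> \<theta> - c *s D_op T \<phi> \<theta>) {-T..T}"
proof -
  note bl = bounded_linear_vector_scalar_mult[of c]
  have d: "\<forall>\<theta>\<in>{-T..T}. (\<phi> has_vector_derivative D_op T \<phi> \<theta>) (at \<theta> within {-T..T})"
    "\<forall>\<theta>\<in>{-T..T}. (\<psi> has_vector_derivative D_op T \<psi> \<theta>) (at \<theta> within {-T..T})"
    "D_op T \<phi> \<in> C_space T" "D_op T \<psi> \<in> C_space T"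
    using C1_space_alt[OF assms(1)] assms(2,3) by blast+
  have "(\<rho> has_vector_derivative D_op T \<psi> \<theta> - c *s D_op T \<phi> \<theta>) (at \<theta> within {-T..T})"
    if "\<theta> \<in> {-T..T}" for \<theta>
  proof (rule has_vector_derivative_transform[OF that])
    show "((\<lambda>\<theta>. \<psi> \<theta> - c *s \<phi> \<theta>) has_vector_derivative D_op T \<psi> \<theta> - c *s D_op T \<phi> \<theta>)
        (at \<theta> within {-T..T})"
      using d(1,2) that
      by (intro has_vector_derivative_diff bounded_linear.has_vector_derivative[OF bl]) auto
  qed (simp add: \<rho>_def)
  moreover have "continuous_on {-T..T} (\<lambda>\<theta>. D_op T \<psi> \<theta> - c *s D_op T \<phi> \<theta>)"
    using d(3,4) by (intro continuous_on_diff bounded_linear.continuous_on[OF bl])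
      (auto simp: C_space_def)
  then have "restrict (\<lambda>\<theta>. D_op T \<psi> \<theta> - c *s D_op T \<phi> \<theta>) {-T..T} \<in> C_space T"
    unfolding C_space_def mem_Collect_eq
    by (metis (mono_tags, lifting) continuous_on_cong restrict_apply restrict_extensional)
  ultimately show ?thesis
    unfolding C1_space_alt[OF assms(1)] by (simp add: \<rho>_def)
qed

lemma R_op_factorization:
  fixes H :: "int \<Rightarrow> real^'m^'m" and \<phi> :: "real \<Rightarrow> complex^'m"
  assumes "\<tau> K > 0" and \<tau>: "\<And>k. k \<in> {1..K} \<Longrightarrow> 0 < \<tau> k \<and> \<tau> k \<le> \<tau> K"
  shows "R_dom H \<tau> K = {\<phi> \<in> ham_dom H \<tau> K. ham_shift (\<tau> K) (- \<sigma>) \<phi> \<in> ham_dom H \<tau> K}"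
    and "\<phi> \<in> R_dom H \<tau> K \<Longrightarrow>
      R_op (\<tau> K) \<sigma> \<phi> = ham_shift (\<tau> K) \<sigma> (ham_shift (\<tau> K) (- \<sigma>) \<phi>)"
proof -
  let ?T = "\<tau> K" and ?I = "{-\<tau> K..\<tau> K}"
  have I: "0 \<in> ?I" "\<And>k. k \<in> {1..K} \<Longrightarrow> \<tau> k \<in> ?I \<and> - \<tau> k \<in> ?I"
    using assms by (force)+
  have lin: "ham_bc H \<tau> K (restrict (\<lambda>\<theta>. \<psi> \<theta> - c *s \<phi> \<theta>) ?I)"
    if "ham_bc H \<tau> K \<phi>" "ham_bc H \<tau> K \<psi>" "\<phi> \<in> C1_space ?T" "\<psi> \<in> C1_space ?T"
    for c and \<phi> \<psi> :: "real \<Rightarrow> complex^'m"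
  proof -
    have D: "D_op ?T (restrict (\<lambda>\<theta>. \<psi> \<theta> - c *s \<phi> \<theta>) ?I) 0 = D_op ?T \<psi> 0 - c *s D_op ?T \<phi> 0"
      using D_op_add_scaled[OF assms(1) that(3,4), of c] I(1) by simp
    have S: "(\<Sum>k=1..K. cmat (H (- int k)) *v restrict (\<lambda>\<theta>. \<psi> \<theta> - c *s \<phi> \<theta>) ?I (- \<tau> k)
          + cmat (H (int k)) *v restrict (\<lambda>\<theta>. \<psi> \<theta> - c *s \<phi> \<theta>) ?I (\<tau> k))
        = (\<Sum>k=1..K. cmat (H (- int k)) *v \<psi> (- \<tau> k) + cmat (H (int k)) *v \<psi> (\<tau> k))
        - c *s (\<Sum>k=1..K. cmat (H (- int k)) *v \<phi> (- \<tau> k) + cmat (H (int k)) *v \<phi> (\<tau> k))"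
      unfolding linear_sum[OF bounded_linear.linear[OF bounded_linear_vector_scalar_mult]]
        sum_subtractf[symmetric]
      using I(2)
      by (intro sum.cong)
        (auto simp: matrix_vector_mult_diff_distrib vector_scalar_commute vec.scale_right_distrib
          algebra_simps)
    show ?thesis
      unfolding ham_bc_def D S using that(1,2) I(1)
      by (simp add: ham_bc_def matrix_vector_mult_diff_distrib vector_scalar_commute
          vec.scale_right_distrib algebra_simps)
  qed
  have Dback: "D_op ?T \<phi> = restrict (\<lambda>\<theta>. ham_shift ?T (- \<sigma>) \<phi> \<theta> - \<sigma> *s \<phi> \<theta>) ?I"
    for \<phi> :: "real \<Rightarrow> complex^'m"
    by (intro extensionalityI[where A = ?I])
      (auto simp: ham_shift_def D_op_def vec_eq_iff)
  show "R_dom H \<tau> K = {\<phi> \<in> ham_dom H \<tau> K. ham_shift (\<tau> K) (- \<sigma>) \<phi> \<in> ham_dom H \<tau> K}"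
  proof (intro set_eqI iffI)
    fix \<phi> assume "\<phi> \<in> R_dom H \<tau> K"
    then show "\<phi> \<in> {\<phi> \<in> ham_dom H \<tau> K. ham_shift (\<tau> K) (- \<sigma>) \<phi> \<in> ham_dom H \<tau> K}"
      using lin[of \<phi> "D_op ?T \<phi>" "-\<sigma>"] D_op_add_scaled[OF assms(1), of \<phi> "D_op ?T \<phi>" "-\<sigma>"]
      by (auto simp: R_dom_def ham_dom_def ham_shift_def)
  next
    fix \<phi> assume a: "\<phi> \<in> {\<phi> \<in> ham_dom H \<tau> K. ham_shift (\<tau> K) (- \<sigma>) \<phi> \<in> ham_dom H \<tau> K}"
    let ?\<psi> = "ham_shift ?T (- \<sigma>) \<phi>"
    have "restrict (\<lambda>\<theta>. ?\<psi> \<theta> - \<sigma> *s \<phi> \<theta>) ?I \<in> C1_space ?T"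
      "ham_bc H \<tau> K (restrict (\<lambda>\<theta>. ?\<psi> \<theta> - \<sigma> *s \<phi> \<theta>) ?I)"
      using a D_op_add_scaled[OF assms(1), of \<phi> ?\<psi> \<sigma>] lin[of \<phi> ?\<psi> \<sigma>]
      by (auto simp: ham_dom_def)
    then show "\<phi> \<in> R_dom H \<tau> K"
      using a unfolding Dback[symmetric] by (auto simp: R_dom_def ham_dom_def)
  qed
  show "R_op (\<tau> K) \<sigma> \<phi> = ham_shift (\<tau> K) \<sigma> (ham_shift (\<tau> K) (- \<sigma>) \<phi>)"
    if "\<phi> \<in> R_dom H \<tau> K"
  proof -
    have "D_op ?T (ham_shift ?T (- \<sigma>) \<phi>)
        = restrict (\<lambda>\<theta>. D_op ?T (D_op ?T \<phi>) \<theta> - (- \<sigma>) *s D_op ?T \<phi> \<theta>) ?I"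
      using D_op_add_scaled[OF assms(1), of \<phi> "D_op ?T \<phi>" "-\<sigma>"] that
      by (auto simp: R_dom_def ham_shift_def[of _ "-\<sigma>"])
    then show ?thesis
      unfolding R_op_def ham_shift_def[of _ \<sigma>]
      by (intro restrict_ext) (simp add: ham_shift_def vec_eq_iff algebra_simps power2_eq_square)
  qed
qed

text \<open>The first argument of each matrix is N, the second the row index l, the third the column
  index j. Rows of A and B are indexed by 1..N+1, rows of Z by 0..N, columns by 2..N+2.\<close>

definition A_mat :: "nat \<Rightarrow> nat \<Rightarrow> nat \<Rightarrow> real" where
  "A_mat N l j =
    (if 1 \<le> l \<and> l \<le> N + 1 \<and> j = l + 1 then 1 / (2 * (real l + 1))
     else if 3 \<le> l \<and> l \<le> N + 1 \<and> j + 1 = l then - 1 / (2 * (real l - 1))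
     else 0)"

definition B_mat :: "nat \<Rightarrow> nat \<Rightarrow> nat \<Rightarrow> real" where
  "B_mat N l j = (if 2 \<le> l \<and> l \<le> N + 1 \<and> j = l then 1 else 0)"

definition Z_mat :: "nat \<Rightarrow> nat \<Rightarrow> nat \<Rightarrow> real" where
  "Z_mat N l j =
    (if l > N then 0
     else if l = 0 then (if j = 2 then 1/4 else 0)
     else if l = 1 then (if j = 3 then 1/24 else 0)
     else if l = 2 then (if j = 2 then - 1/6 else if j = 4 then 1/48 else 0)
     else if j = l + 2 then 1 / (4 * (real l + 1) * (real l + 2))
     else if j = l then - 1 / (2 * (real l - 1) * (real l + 1))
     else if l \<ge> 4 \<and> j + 2 = l then 1 / (4 * (real l - 1) * (real l - 2))
     else 0)"

definition cheb_osc :: "nat \<Rightarrow> real \<Rightarrow> real \<Rightarrow> (nat \<Rightarrow> complex^'m) \<Rightarrow> (real \<Rightarrow> complex^'m)" where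
  "cheb_osc L T \<omega> c = restrict (\<lambda>\<theta>.
      exp (\<i> * of_real (\<omega> * \<theta>)) *s (\<Sum>l=0..L. of_real (poly (cheb l) (\<theta> / T)) *s c l)
    + exp (- (\<i> * of_real (\<omega> * \<theta>))) *s (\<Sum>l=0..L. of_real (poly (cheb l) (\<theta> / T)) *s vcnj (c l)))
    {-T..T}"

text \<open>Columns 2..N+2 of [v_1 ... v_{N+1}] (2 i \<omega> T A_N + B_N) = T^2 [q_0 ... q_N] Z_N.\<close>

definition coeff_system ::
  "nat \<Rightarrow> real \<Rightarrow> real \<Rightarrow> (nat \<Rightarrow> complex^'m) \<Rightarrow> (nat \<Rightarrow> complex^'m) \<Rightarrow> bool" where
  "coeff_system N T \<omega> q v \<longleftrightarrow>
    (\<forall>j\<in>{2..N+2}.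
       (\<Sum>l=1..N+1. (2 * \<i> * of_real \<omega> * of_real T * of_real (A_mat N l j)
                      + of_real (B_mat N l j)) *s v l)
     = of_real (T\<^sup>2) *s (\<Sum>l=0..N. of_real (Z_mat N l j) *s q l))"

text \<open>The sum, at \<open>t\<close> in \<open>[-T, T]\<close>, over l = 1..N+1 of
  Re (v_l e^{i \<omega> t}) T_l'(t/T) / T + i \<omega> v_l T_l(t/T) e^{i \<omega> t}.\<close>

definition v0_sum :: "nat \<Rightarrow> real \<Rightarrow> real \<Rightarrow> (nat \<Rightarrow> complex^'m) \<Rightarrow> real \<Rightarrow> complex^'m" where
  "v0_sum N T \<omega> v t =
    (\<Sum>l=1..N+1.
        of_real (poly (pderiv (cheb l)) (t / T) / T) *s vRe (exp (\<i> * of_real (\<omega> * t)) *s v l)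
      + (\<i> * of_real \<omega> * of_real (poly (cheb l) (t / T)) * exp (\<i> * of_real (\<omega> * t))) *s v l)"

definition v0_system ::
  "(int \<Rightarrow> real^'m^'m) \<Rightarrow> (nat \<Rightarrow> real) \<Rightarrow> nat \<Rightarrow> nat \<Rightarrow> real
     \<Rightarrow> (nat \<Rightarrow> complex^'m) \<Rightarrow> (nat \<Rightarrow> complex^'m) \<Rightarrow> bool" where
  "v0_system H \<tau> K N \<omega> q v \<longleftrightarrow>
     (\<i> * of_real \<omega>) *s (char_mat H \<tau> K (\<i> * of_real \<omega>) *v v 0)
     = (cmat (H 0) - mat (\<i> * of_real \<omega>)) *v
         (\<Sum>l=1..N+1. of_real (poly (pderiv (cheb l)) 0 / \<tau> K) *s vRe (v l)
                     + (\<i> * of_real \<omega> * of_real (poly (cheb l) 0)) *s v l)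
       + (\<Sum>k=1..K. cmat (H (int k)) *v v0_sum N (\<tau> K) \<omega> v (\<tau> k)
                  + cmat (H (- int k)) *v v0_sum N (\<tau> K) \<omega> v (- \<tau> k))
       - (\<Sum>l=0..N. of_real (poly (cheb l) 0) *s vRe (q l))"

end

theory Submission
  imports Defs
begin

text \<open>Write \<open>z = i\<omega>\<close>, let \<open>P\<close> and \<open>Q\<close> be the Chebyshev sums with coefficients \<open>v\<close> and \<open>q\<close> in the
  variable \<open>\<theta> / \<tau> K\<close>, and let a dash on them denote the derivative in \<open>\<theta>\<close>.

  Invertibility. The operator factors into first-order shifts by \<open>z\<close> and \<open>- z\<close>. Variation of
  constants turns \<open>\<phi>' - \<sigma> \<phi> = \<psi>\<close> with the boundary condition into a linear system with the
  characteristic matrix at \<open>\<sigma>\<close>. That matrix is injective, because a kernel vector \<open>x\<close> would give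
  the eigenfunction \<open>exp (\<sigma> \<theta>) x\<close>; so each shift is bijective onto the continuous functions when
  \<open>\<sigma>\<close> is not an eigenvalue (\<open>ham_shift_bij\<close>). As the data are real, eigenvalues come in conjugate
  pairs, and the hypothesis on \<open>z\<close> also covers \<open>- z\<close>.

  Differential equation. Inserting the ansatz \<open>F + cnj F\<close> with \<open>F = exp (z \<theta>) P\<close> and cancelling the
  exponential leaves \<open>P'' + 2 z P' = Q\<close>. The coefficient system says exactly this when all
  three functions are expanded in the second derivatives \<open>T_2'', T_3'', \<dots>\<close>: the rows of the
  matrices \<open>A\<close>, \<open>B\<close> and \<open>Z\<close> are the coordinates of \<open>T_l'\<close>, \<open>T_l''\<close> and \<open>T_l\<close> with respect to them
  (\<open>A_mat_sum\<close>, \<open>B_mat_sum\<close>, \<open>Z_mat_sum\<close>). The system is triangular with nonzero diagonal, hence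
  uniquely solvable by back substitution.

  Boundary conditions. The two conditions on \<open>\<phi>\<close> and \<open>\<phi>'\<close> are real, so they hold together if and
  only if the single complex condition for \<open>\<phi>' + z \<phi>\<close> holds. In \<open>\<phi>' + z \<phi>\<close> the constant
  coefficient \<open>v 0\<close> enters only through \<open>2 z exp (z \<theta>) v 0\<close>: in \<open>z \<phi>\<close> the conjugate part cancels
  against \<open>\<phi>'\<close>. The condition therefore becomes a linear system for \<open>v 0\<close> with the invertible matrix
  \<open>z M(z)\<close>, which is the one stated (\<open>v0_sum_eq\<close>, \<open>R_op_cheb_osc\<close>).\<close>

section \<open>Vectors, real matrices and derivatives\<close>

lemma vcnj_simps [simp]:
  "vcnj (x + y) = vcnj x + vcnj y" "vcnj (x - y) = vcnj x - vcnj y"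
  "vcnj (c *s x) = cnj c *s vcnj x" "vcnj (vcnj x) = x" "vcnj 0 = 0"
  by (simp_all add: vcnj_def vec_eq_iff)

lemma vcnj_sum: "vcnj (\<Sum>a\<in>S. f a) = (\<Sum>a\<in>S. vcnj (f a))"
  by (simp add: vcnj_def vec_eq_iff)

lemma vcnj_cmat_mult: "vcnj (cmat A *v x) = cmat A *v vcnj x"
  by (simp add: vcnj_def vec_eq_iff matrix_vector_mult_def cmat_def map_matrix_def)

lemma bounded_linear_vcnj: "bounded_linear (vcnj :: complex^'m::finite \<Rightarrow> complex^'m)"
proof -
  have "linear (vcnj :: complex^'m \<Rightarrow> complex^'m)"
    by (rule linearI) (simp_all add: vcnj_def vec_eq_iff)
  then show ?thesis by (simp add: linear_conv_bounded_linear)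
qed

lemma bounded_bilinear_vector_scalar_mult:
  "bounded_bilinear (\<lambda>(c::complex) (x::complex^'m::finite). c *s x)"
  unfolding bilinear_conv_bounded_bilinear[symmetric] bilinear_def
  by (auto intro!: linearI simp: vec_eq_iff algebra_simps)

lemma has_vector_derivative_cexp:
  "((\<lambda>\<theta>. exp ((z::complex) * of_real \<theta>)) has_vector_derivative z * exp (z * of_real \<theta>)) (at \<theta> within S)"
  by (rule has_vector_derivative_real_field) (auto intro!: derivative_eq_intros)

lemma has_vector_derivative_cexp_scale:
  fixes g :: "real \<Rightarrow> complex^'m::finite"
  assumes "(g has_vector_derivative g') (at \<theta> within S)"
  shows "((\<lambda>\<theta>. exp (z * of_real \<theta>) *s g \<theta>) has_vector_derivative
      exp (z * of_real \<theta>) *s (g' + z *s g \<theta>)) (at \<theta> within S)"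
proof -
  have "exp (z * of_real \<theta>) *s (g' + z *s g \<theta>)
      = exp (z * of_real \<theta>) *s g' + (z * exp (z * of_real \<theta>)) *s g \<theta>"
    by (simp add: vec_eq_iff algebra_simps)
  with bounded_bilinear.has_vector_derivative[OF bounded_bilinear_vector_scalar_mult
      has_vector_derivative_cexp assms, of z]
  show ?thesis by (simp only:)
qed

lemma restrict_C_space:
  "continuous_on {-T..T} f \<Longrightarrow> restrict f {-T..T} \<in> C_space T"
  unfolding C_space_def mem_Collect_eq
  by (metis (mono_tags, lifting) continuous_on_cong restrict_apply restrict_extensional)

text \<open>Lets derivatives be computed for functions on the whole line, restricting to the interval only at
  the end.\<close>

lemma C1_space_restrict:
  fixes f :: "real \<Rightarrow> complex^'m::finite"
  assumes "T > 0" "continuous_on {-T..T} f'"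
    and "\<And>\<theta>. \<theta> \<in> {-T..T} \<Longrightarrow> (f has_vector_derivative f' \<theta>) (at \<theta> within {-T..T})"
  shows "restrict f {-T..T} \<in> C1_space T" "D_op T (restrict f {-T..T}) = restrict f' {-T..T}"
proof -
  have "(restrict f {-T..T} has_vector_derivative restrict f' {-T..T} \<theta>) (at \<theta> within {-T..T})"
    if "\<theta> \<in> {-T..T}" for \<theta>
    using has_vector_derivative_transform[OF that _ assms(3)[OF that], of "restrict f {-T..T}"] that
    by simp
  then have "restrict f {-T..T} \<in> C1_space T \<and> D_op T (restrict f {-T..T}) = restrict f' {-T..T}"
    unfolding C1_space_alt[OF assms(1)] using restrict_C_space[OF assms(2)] by simp
  then show "restrict f {-T..T} \<in> C1_space T"
    "D_op T (restrict f {-T..T}) = restrict f' {-T..T}" by auto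
qed

lemma D_op_has_vector_derivative:
  assumes "T > 0" "\<phi> \<in> C1_space T" "\<theta> \<in> {-T..T}"
  shows "(\<phi> has_vector_derivative D_op T \<phi> \<theta>) (at \<theta> within {-T..T})"
  using C1_space_alt[OF assms(1)] assms by blast

section \<open>The delay functional and the characteristic matrix\<close>

definition delay_rhs ::
  "(int \<Rightarrow> real^'m^'m) \<Rightarrow> (nat \<Rightarrow> real) \<Rightarrow> nat \<Rightarrow> (real \<Rightarrow> complex^'m) \<Rightarrow> complex^'m::finite" where
  "delay_rhs H \<tau> K \<phi> = cmat (H 0) *v \<phi> 0
     + (\<Sum>k=1..K. cmat (H (- int k)) *v \<phi> (- \<tau> k) + cmat (H (int k)) *v \<phi> (\<tau> k))"

lemma ham_bc_iff: "ham_bc H \<tau> K \<phi> \<longleftrightarrow> D_op (\<tau> K) \<phi> 0 = delay_rhs H \<tau> K \<phi>"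
  by (simp add: ham_bc_def delay_rhs_def)

lemma delay_rhs_add:
  "delay_rhs H \<tau> K (\<lambda>\<theta>. f \<theta> + g \<theta>) = delay_rhs H \<tau> K f + delay_rhs H \<tau> K g"
  by (simp add: delay_rhs_def matrix_vector_right_distrib sum.distrib algebra_simps)

lemma delay_rhs_scale: "delay_rhs H \<tau> K (\<lambda>\<theta>. c *s f \<theta>) = c *s delay_rhs H \<tau> K f"
proof -
  have "c *s (\<Sum>k=1..K. g k) = (\<Sum>k=1..K. c *s g k)" for g :: "nat \<Rightarrow> complex^'a"
    by (simp add: vec_eq_iff sum_distrib_left)
  then show ?thesis
    by (simp add: delay_rhs_def vector_scalar_commute vec.scale_right_distrib)
qed

lemma delay_rhs_vcnj: "delay_rhs H \<tau> K (\<lambda>\<theta>. vcnj (f \<theta>)) = vcnj (delay_rhs H \<tau> K f)"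
  by (simp add: delay_rhs_def vcnj_cmat_mult vcnj_sum)

text \<open>The functional \<open>delay_rhs\<close> only samples its argument at 0 and at the delays, all of which lie in
  the interval; hence it cannot distinguish a function from its restriction.\<close>

locale delay_operator =
  fixes H :: "int \<Rightarrow> real^'m::finite^'m" and \<tau> :: "nat \<Rightarrow> real" and K :: nat
  assumes horizon_pos: "0 < \<tau> K"
    and delay_bounds: "k \<in> {1..K} \<Longrightarrow> 0 < \<tau> k \<and> \<tau> k \<le> \<tau> K"
begin

lemma delay_rhs_cong:
  assumes "\<And>\<theta>. \<theta> \<in> {-\<tau> K..\<tau> K} \<Longrightarrow> f \<theta> = g \<theta>"
  shows "delay_rhs H \<tau> K f = delay_rhs H \<tau> K g"
proof -
  have "f 0 = g 0" using horizon_pos assms by auto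
  moreover have "f (\<tau> k) = g (\<tau> k)" "f (- \<tau> k) = g (- \<tau> k)" if "k \<in> {1..K}" for k
    using delay_bounds[OF that] assms by auto
  ultimately show ?thesis unfolding delay_rhs_def by (auto intro!: sum.cong)
qed

end

lemma matrix_vector_mult_sum_left:
  fixes A :: "'b \<Rightarrow> complex^'m::finite^'k::finite"
  shows "(\<Sum>a\<in>S. A a) *v x = (\<Sum>a\<in>S. A a *v x)"
  by (induction S rule: infinite_finite_induct) (auto simp: matrix_vector_mult_add_rdistrib)

lemma mat_vector_mult: "mat c *v x = (c::complex) *s x"
  by (simp add: vec_eq_iff matrix_vector_mult_def mat_def if_distrib [where f = "\<lambda>a. a * _"]
      cong: if_cong)

text \<open>The characteristic matrix is the boundary condition evaluated on an exponential function.\<close>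

lemma char_mat_mult:
  "char_mat H \<tau> K z *v x = z *s x - delay_rhs H \<tau> K (\<lambda>\<theta>. exp (z * of_real \<theta>) *s x)"
proof -
  have m: "map_matrix (\<lambda>h. h * e) A *v x = A *v (e *s x)" for e and A :: "complex^'a^'a"
    by (simp add: vec_eq_iff matrix_vector_mult_def map_matrix_def algebra_simps)
  show ?thesis
    by (simp add: char_mat_def delay_rhs_def matrix_vector_mult_diff_rdistrib
        matrix_vector_mult_add_rdistrib matrix_vector_mult_sum_left m mat_vector_mult)
qed

section \<open>Invertibility of the second-order operator\<close>

context delay_operator
begin

lemma ham_dom_restrict:
  fixes f :: "real \<Rightarrow> complex^'m"
  assumes "continuous_on {-\<tau> K..\<tau> K} f'"
    and "\<And>\<theta>. \<theta> \<in> {-\<tau> K..\<tau> K} \<Longrightarrow> (f has_vector_derivative f' \<theta>) (at \<theta> within {-\<tau> K..\<tau> K})"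
    and "f' 0 = delay_rhs H \<tau> K f"
  shows "restrict f {-\<tau> K..\<tau> K} \<in> ham_dom H \<tau> K"
    "D_op (\<tau> K) (restrict f {-\<tau> K..\<tau> K}) = restrict f' {-\<tau> K..\<tau> K}"
proof -
  note C = C1_space_restrict[OF horizon_pos assms(1,2)]
  have "delay_rhs H \<tau> K (restrict f {-\<tau> K..\<tau> K}) = delay_rhs H \<tau> K f"
    by (rule delay_rhs_cong) auto
  then show "restrict f {-\<tau> K..\<tau> K} \<in> ham_dom H \<tau> K"
    "D_op (\<tau> K) (restrict f {-\<tau> K..\<tau> K}) = restrict f' {-\<tau> K..\<tau> K}"
    using C assms(3) horizon_pos by (auto simp: ham_dom_def ham_bc_iff)
qed

text \<open>A vector \<open>x\<close> in the kernel makes \<open>exp (\<sigma> \<theta>) x\<close> satisfy the boundary condition, so a nonzero one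
  would be an eigenvector.\<close>

lemma char_mat_injective:
  assumes "\<not> ham_eigenvalue H \<tau> K \<sigma>" and "char_mat H \<tau> K \<sigma> *v x = 0"
  shows "x = 0"
proof (rule ccontr)
  assume "x \<noteq> 0"
  let ?I = "{-\<tau> K..\<tau> K}"
  let ?f = "\<lambda>\<theta>. exp (\<sigma> * of_real \<theta>) *s x"
  have d: "(?f has_vector_derivative \<sigma> *s ?f \<theta>) (at \<theta> within S)" for \<theta> S
    using has_vector_derivative_cexp_scale[of "\<lambda>_. x" 0 \<theta> S \<sigma>]
    by (simp add: vec_eq_iff algebra_simps)
  have "continuous_on ?I ?f"
    using has_vector_derivative_continuous d continuous_on_eq_continuous_within by blast
  then have c: "continuous_on ?I (\<lambda>\<theta>. \<sigma> *s ?f \<theta>)"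
    by (rule bounded_linear.continuous_on[OF bounded_linear_vector_scalar_mult])
  have "\<sigma> *s ?f 0 = delay_rhs H \<tau> K ?f" using assms(2) by (simp add: char_mat_mult)
  note D = ham_dom_restrict[OF c d this]
  have "ham_eigenvalue H \<tau> K \<sigma>"
    unfolding ham_eigenvalue_def
    using D horizon_pos \<open>x \<noteq> 0\<close> by (intro bexI[of _ "restrict ?f ?I"] conjI bexI[of _ 0]) auto
  with assms(1) show False by simp
qed

lemma char_mat_bij:
  assumes "\<not> ham_eigenvalue H \<tau> K \<sigma>"
  shows "bij (\<lambda>x. char_mat H \<tau> K \<sigma> *v x)"
proof -
  have "inj (\<lambda>x. char_mat H \<tau> K \<sigma> *v x)"
  proof (rule injI)
    fix x y assume "char_mat H \<tau> K \<sigma> *v x = char_mat H \<tau> K \<sigma> *v y"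
    then have "char_mat H \<tau> K \<sigma> *v (x - y) = 0" by (simp add: matrix_vector_mult_diff_distrib)
    from char_mat_injective[OF assms this] show "x = y" by simp
  qed
  then show ?thesis
    using vec.linear_injective_imp_surjective matrix_vector_mul_linear_gen bij_def by blast
qed

text \<open>The difference of two preimages satisfies the eigenvalue equation, hence vanishes. A preimage of
  \<open>\<psi>\<close> has the form \<open>exp (\<sigma> \<theta>) (c + g \<theta>)\<close> with \<open>g\<close> a primitive of \<open>exp (- \<sigma> \<theta>) \<psi> \<theta>\<close>; the
  boundary condition is then a linear system for \<open>c\<close> with the characteristic matrix.\<close>

lemma ham_shift_bij:
  assumes "\<not> ham_eigenvalue H \<tau> K \<sigma>"
  shows "bij_betw (ham_shift (\<tau> K) \<sigma>) (ham_dom H \<tau> K) (C_space (\<tau> K))"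
  unfolding bij_betw_def
proof (intro conjI inj_onI subset_antisym subsetI)
  let ?I = "{-\<tau> K..\<tau> K}"
  fix \<phi> \<psi> assume a: "\<phi> \<in> ham_dom H \<tau> K" "\<psi> \<in> ham_dom H \<tau> K"
    and eq: "ham_shift (\<tau> K) \<sigma> \<phi> = ham_shift (\<tau> K) \<sigma> \<psi>"
  let ?r = "restrict (\<lambda>\<theta>. \<psi> \<theta> - 1 *s \<phi> \<theta>) ?I"
  have C: "\<phi> \<in> C1_space (\<tau> K)" "\<psi> \<in> C1_space (\<tau> K)" using a by (auto simp: ham_dom_def)
  note D = D_op_add_scaled[OF horizon_pos C, of 1]
  have "delay_rhs H \<tau> K ?r = delay_rhs H \<tau> K (\<lambda>\<theta>. \<psi> \<theta> + (-1) *s \<phi> \<theta>)"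
    by (rule delay_rhs_cong) auto
  then have "ham_bc H \<tau> K ?r"
    using a D horizon_pos unfolding delay_rhs_add delay_rhs_scale by (auto simp: ham_dom_def ham_bc_iff)
  with D have "?r \<in> ham_dom H \<tau> K" by (simp add: ham_dom_def)
  moreover have "D_op (\<tau> K) ?r \<theta> = \<sigma> *s ?r \<theta>" if "\<theta> \<in> ?I" for \<theta>
    using that fun_cong[OF eq, of \<theta>] D by (simp add: ham_shift_def vec_eq_iff algebra_simps)
  ultimately have "\<forall>\<theta>\<in>?I. ?r \<theta> = 0"
    using assms unfolding ham_eigenvalue_def by blast
  with C show "\<phi> = \<psi>"
    by (intro extensionalityI[where A = ?I]) (auto simp: C1_space_def C_space_def)
next
  fix \<psi> assume "\<psi> \<in> ham_shift (\<tau> K) \<sigma> ` ham_dom H \<tau> K"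
  then obtain \<phi> where \<phi>: "\<phi> \<in> C1_space (\<tau> K)" "\<psi> = ham_shift (\<tau> K) \<sigma> \<phi>"
    by (auto simp: ham_dom_def)
  then show "\<psi> \<in> C_space (\<tau> K)"
    unfolding \<phi>(2) ham_shift_def
    by (intro restrict_C_space continuous_on_diff
        bounded_linear.continuous_on[OF bounded_linear_vector_scalar_mult])
      (auto simp: C1_space_def C_space_def)
next
  let ?I = "{-\<tau> K..\<tau> K}"
  fix \<psi> :: "real \<Rightarrow> complex^'m" assume \<psi>: "\<psi> \<in> C_space (\<tau> K)"
  let ?e = "\<lambda>\<theta>. exp (\<sigma> * of_real \<theta>)"
  have "continuous_on ?I (\<lambda>\<theta>. exp (- \<sigma> * of_real \<theta>) *s \<psi> \<theta>)"
    using \<psi> by (intro bounded_bilinear.continuous_on[OF bounded_bilinear_vector_scalar_mult]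
        continuous_intros) (auto simp: C_space_def)
  then obtain g where g: "\<And>\<theta>. \<theta> \<in> ?I \<Longrightarrow>
      (g has_vector_derivative exp (- \<sigma> * of_real \<theta>) *s \<psi> \<theta>) (at \<theta> within ?I)"
    using antiderivative_continuous by blast
  obtain c where c: "delay_rhs H \<tau> K (\<lambda>\<theta>. ?e \<theta> *s g \<theta>) - \<sigma> *s g 0 - \<psi> 0
      = char_mat H \<tau> K \<sigma> *v c"
    by (rule surjE[OF bij_is_surj[OF char_mat_bij[OF assms]]])
  let ?f = "\<lambda>\<theta>. ?e \<theta> *s (c + g \<theta>)"
  have d: "(?f has_vector_derivative \<psi> \<theta> + \<sigma> *s ?f \<theta>) (at \<theta> within ?I)" if "\<theta> \<in> ?I" for \<theta>
  proof -
    have "((\<lambda>\<theta>. c + g \<theta>) has_vector_derivative exp (- \<sigma> * of_real \<theta>) *s \<psi> \<theta>) (at \<theta> within ?I)"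
      using has_vector_derivative_add[OF has_vector_derivative_const g[OF that], of c] by simp
    from has_vector_derivative_cexp_scale[OF this, of \<sigma>] show ?thesis
      by (simp add: vec.scale_right_distrib exp_minus mult.commute)
  qed
  have "continuous_on ?I ?f"
    using has_vector_derivative_continuous d continuous_on_eq_continuous_within by blast
  then have cont: "continuous_on ?I (\<lambda>\<theta>. \<psi> \<theta> + \<sigma> *s ?f \<theta>)"
    using \<psi> by (intro continuous_on_add
        bounded_linear.continuous_on[OF bounded_linear_vector_scalar_mult]) (auto simp: C_space_def)
  have bc: "\<psi> 0 + \<sigma> *s ?f 0 = delay_rhs H \<tau> K ?f"
    using c unfolding vec.scale_right_distrib delay_rhs_add char_mat_mult
    by (simp add: vec.scale_right_distrib algebra_simps)
  note D = ham_dom_restrict[OF cont d bc]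
  have "\<psi> = ham_shift (\<tau> K) \<sigma> (restrict ?f ?I)"
    using D \<psi> by (intro extensionalityI[where A = ?I]) (auto simp: ham_shift_def C_space_def)
  with D show "\<psi> \<in> ham_shift (\<tau> K) \<sigma> ` ham_dom H \<tau> K" by blast
qed

text \<open>The matrices are real, so conjugating an eigenfunction gives another one.\<close>

lemma ham_eigenvalue_cnj:
  assumes "ham_eigenvalue H \<tau> K \<sigma>"
  shows "ham_eigenvalue H \<tau> K (cnj \<sigma>)"
proof -
  let ?I = "{-\<tau> K..\<tau> K}"
  obtain \<phi> \<theta>\<^sub>0 where \<phi>: "\<phi> \<in> C1_space (\<tau> K)" "D_op (\<tau> K) \<phi> 0 = delay_rhs H \<tau> K \<phi>"
    "\<theta>\<^sub>0 \<in> ?I" "\<phi> \<theta>\<^sub>0 \<noteq> 0" "\<And>\<theta>. \<theta> \<in> ?I \<Longrightarrow> D_op (\<tau> K) \<phi> \<theta> = \<sigma> *s \<phi> \<theta>"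
    using assms by (auto simp: ham_eigenvalue_def ham_dom_def ham_bc_iff)
  have cont: "continuous_on ?I (\<lambda>\<theta>. vcnj (D_op (\<tau> K) \<phi> \<theta>))"
    using \<phi>(1) by (intro bounded_linear.continuous_on[OF bounded_linear_vcnj])
      (auto simp: C1_space_def C_space_def)
  have d: "((\<lambda>\<theta>. vcnj (\<phi> \<theta>)) has_vector_derivative vcnj (D_op (\<tau> K) \<phi> \<theta>)) (at \<theta> within ?I)"
    if "\<theta> \<in> ?I" for \<theta>
    using D_op_has_vector_derivative[OF horizon_pos \<phi>(1) that]
    by (rule bounded_linear.has_vector_derivative[OF bounded_linear_vcnj])
  have "vcnj (D_op (\<tau> K) \<phi> 0) = delay_rhs H \<tau> K (\<lambda>\<theta>. vcnj (\<phi> \<theta>))"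
    by (simp add: \<phi>(2) delay_rhs_vcnj)
  note D = ham_dom_restrict[OF cont d this]
  have "vcnj (\<phi> \<theta>\<^sub>0) \<noteq> 0" using \<phi>(4) vcnj_simps(4,5) by metis
  then show ?thesis
    unfolding ham_eigenvalue_def using D \<phi>(3,5)
    by (intro bexI[of _ "restrict (\<lambda>\<theta>. vcnj (\<phi> \<theta>)) ?I"] conjI bexI[of _ \<theta>\<^sub>0]) auto
qed

lemma bij_betw_preimage:
  assumes "bij_betw f A B" "B' \<subseteq> B"
  shows "bij_betw f {x \<in> A. f x \<in> B'} B'"
  using assms by (auto simp: bij_betw_def inj_on_def)

text \<open>The second-order operator is the shift by \<open>\<sigma>\<close> after the shift by \<open>- \<sigma>\<close>, and its domain is
  the preimage under the latter of the domain of the former, so that both factors are bijections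
  between exactly the right sets.\<close>

lemma R_op_bij:
  assumes "\<not> ham_eigenvalue H \<tau> K \<sigma>" "\<not> ham_eigenvalue H \<tau> K (- \<sigma>)"
  shows "bij_betw (R_op (\<tau> K) \<sigma>) (R_dom H \<tau> K) (C_space (\<tau> K))"
proof -
  note fact = R_op_factorization[where H = H and \<tau> = \<tau> and K = K and \<sigma> = \<sigma>, OF horizon_pos delay_bounds]
  let ?S = "ham_shift (\<tau> K)"
  have "ham_dom H \<tau> K \<subseteq> C_space (\<tau> K)" by (auto simp: ham_dom_def C1_space_def)
  from bij_betw_preimage[OF ham_shift_bij[OF assms(2)] this]
  have "bij_betw (?S (- \<sigma>)) (R_dom H \<tau> K) (ham_dom H \<tau> K)"
    by (simp only: fact(1))
  from bij_betw_trans[OF this ham_shift_bij[OF assms(1)]]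
  have "bij_betw (?S \<sigma> \<circ> ?S (- \<sigma>)) (R_dom H \<tau> K) (C_space (\<tau> K))" .
  moreover have "R_op (\<tau> K) \<sigma> \<phi> = (?S \<sigma> \<circ> ?S (- \<sigma>)) \<phi>" if "\<phi> \<in> R_dom H \<tau> K" for \<phi>
    using fact(2)[OF _ that] by simp
  then have "bij_betw (R_op (\<tau> K) \<sigma>) (R_dom H \<tau> K) (C_space (\<tau> K))
      \<longleftrightarrow> bij_betw (?S \<sigma> \<circ> ?S (- \<sigma>)) (R_dom H \<tau> K) (C_space (\<tau> K))"
    by (rule bij_betw_cong)
  ultimately show ?thesis by (rule iffD2[rotated])
qed

end

section \<open>Chebyshev polynomials as combinations of second derivatives\<close>

text \<open>The Chebyshev polynomials of the second kind with the index shifted by one: \<open>cheb_second n\<close> is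
  \<open>U_{n-1}\<close>, where \<open>U_{-1} = 0\<close>. The shift makes \<open>T_n' = n U_{n-1}\<close> true for \<open>n = 0\<close> as well.\<close>

fun cheb_second :: "nat \<Rightarrow> real poly" where
  "cheb_second 0 = 0"
| "cheb_second (Suc 0) = 1"
| "cheb_second (Suc (Suc n)) = [:0, 2:] * cheb_second (Suc n) - cheb_second n"

lemma cheb_eq_second_diff:
  "2 * cheb (Suc n) = cheb_second (Suc (Suc n)) - cheb_second n"
proof (induction n rule: cheb.induct)
  case (3 n)
  have "2 * cheb (Suc (Suc (Suc n))) = [:0, 2:] * (2 * cheb (Suc (Suc n))) - 2 * cheb (Suc n)"
    by (simp only: cheb.simps(3)) (simp add: poly_eq_poly_eq_iff[symmetric] fun_eq_iff algebra_simps)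
  also have "\<dots> = cheb_second (Suc (Suc (Suc (Suc n)))) - cheb_second (Suc (Suc n))"
    unfolding 3 by (simp add: algebra_simps smult_diff_right)
  finally show ?case .
qed (simp_all add: poly_eq_poly_eq_iff[symmetric] fun_eq_iff algebra_simps)

lemma pderiv_cheb: "pderiv (cheb n) = smult (real n) (cheb_second n)"
proof (induction n rule: cheb.induct)
  case (3 n)
  have "pderiv (cheb (Suc (Suc n))) = 2 * cheb (Suc n) + [:0, 2:] * smult (real (Suc n)) (cheb_second (Suc n))
      - smult (real n) (cheb_second n)"
    using 3 by (simp add: pderiv_diff pderiv_smult pderiv_pCons numeral_poly ac_simps)
  also have "\<dots> = smult (real (Suc (Suc n))) (cheb_second (Suc (Suc n)))"
    unfolding cheb_eq_second_diff
    by (simp add: poly_eq_poly_eq_iff[symmetric] fun_eq_iff algebra_simps)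
  finally show ?case .
qed (simp_all add: pderiv_1 pderiv_pCons)

text \<open>The integration rule for Chebyshev polynomials, read backwards: eliminate the polynomials of the
  second kind from \<open>2 T_l = U_l - U_{l-2}\<close> and \<open>T_n' = n U_{n-1}\<close>. Two applications of it produce all
  matrix entries.\<close>

lemma cheb_eq_pderiv:
  assumes "l \<ge> 2"
  shows "cheb l = smult (1 / (2 * (real l + 1))) (pderiv (cheb (l + 1)))
      - smult (1 / (2 * (real l - 1))) (pderiv (cheb (l - 1)))"
proof -
  obtain n where l: "l = Suc n" "n \<ge> 1" using assms by (cases l) auto
  have c: "1 / (2 * (real l + 1)) * real (l + 1) = 1/2" "1 / (2 * (real l - 1)) * real (l - 1) = 1/2"
    using l by (simp_all add: field_simps)
  have "cheb l = smult (1/2) (2 * cheb (Suc n))" by (simp add: l numeral_poly)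
  also have "\<dots> = smult (1/2) (cheb_second (l + 1)) - smult (1/2) (cheb_second (l - 1))"
    unfolding cheb_eq_second_diff by (simp add: l smult_diff_right)
  finally show ?thesis unfolding pderiv_cheb smult_smult c .
qed

definition cheb_dd :: "real \<Rightarrow> nat \<Rightarrow> real" where
  "cheb_dd x j = poly (pderiv (pderiv (cheb j))) x"

lemma cheb_dd_0_1 [simp]: "cheb_dd x 0 = 0" "cheb_dd x (Suc 0) = 0"
  by (simp_all add: cheb_dd_def pderiv_1 pderiv_pCons)

lemma poly_pderiv_cheb_dd:
  assumes "l \<ge> 2"
  shows "poly (pderiv (cheb l)) x
    = cheb_dd x (l + 1) / (2 * (real l + 1)) - cheb_dd x (l - 1) / (2 * (real l - 1))"
  by (subst cheb_eq_pderiv[OF assms]) (simp add: cheb_dd_def pderiv_diff pderiv_smult)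

lemma poly_cheb_pderiv:
  assumes "l \<ge> 2"
  shows "poly (cheb l) x = poly (pderiv (cheb (l + 1))) x / (2 * (real l + 1))
      - poly (pderiv (cheb (l - 1))) x / (2 * (real l - 1))"
  by (subst cheb_eq_pderiv[OF assms]) simp

lemma cheb_low:
  "poly (cheb 0) x = cheb_dd x 2 / 4" "poly (pderiv (cheb (Suc 0))) x = cheb_dd x 2 / 4"
  "poly (cheb (Suc 0)) x = poly (pderiv (cheb 2)) x / 4"
  by (simp_all add: cheb_dd_def numeral_2_eq_2 pderiv_1 pderiv_pCons pderiv_diff)

text \<open>From here on the polynomials are treated as symbols and the sums over their indices stay closed.\<close>

lemmas [simp del] = cheb.simps sum.cl_ivl_Suc

text \<open>For \<open>l = 2\<close> the rule would also contribute a multiple of \<open>T_1''\<close>; it vanishes, which is why the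
  matrix has no entry for it. The same effect removes entries from \<open>B\<close> for \<open>l = 1\<close> and from \<open>Z\<close> for
  \<open>l = 1\<close> and \<open>l = 3\<close>.\<close>

lemma A_mat_sum:
  assumes "1 \<le> l" "l \<le> N + 1"
  shows "(\<Sum>j=2..N+2. A_mat N l j * cheb_dd x j) = poly (pderiv (cheb l)) x"
proof -
  have "(\<Sum>j=2..N+2. A_mat N l j * cheb_dd x j)
      = (\<Sum>j=2..N+2. (if j = l + 1 then cheb_dd x (l + 1) / (2 * (real l + 1)) else 0)
          + (if j = l - 1 then - cheb_dd x (l - 1) / (2 * (real l - 1)) else 0))"
    using assms by (intro sum.cong) (auto simp: A_mat_def)
  also have "\<dots> = poly (pderiv (cheb l)) x"
  proof (cases "l = 1")
    case True
    then show ?thesis using cheb_low(2)[of x] by (simp add: sum.distrib numeral_2_eq_2)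
  next
    case False
    show ?thesis
    proof (cases "l = 2")
      case True
      then show ?thesis
        using assms poly_pderiv_cheb_dd[of l x] by (simp add: sum.distrib)
    next
      case l: False
      have "l + 1 \<in> {2..N+2}" "l - 1 \<in> {2..N+2}" using False l assms by auto
      then show ?thesis
        using False assms poly_pderiv_cheb_dd[of l x]
        by (simp only: sum.distrib sum.delta finite_atLeastAtMost if_True)
    qed
  qed
  finally show ?thesis .
qed

lemma B_mat_sum:
  assumes "1 \<le> l" "l \<le> N + 1"
  shows "(\<Sum>j=2..N+2. B_mat N l j * cheb_dd x j) = cheb_dd x l"
proof -
  have "(\<Sum>j=2..N+2. B_mat N l j * cheb_dd x j) = (\<Sum>j=2..N+2. if j = l then cheb_dd x l else 0)"
    using assms by (intro sum.cong) (auto simp: B_mat_def)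
  then show ?thesis using assms by (cases "l = 1") simp_all
qed

lemma Z_mat_sum:
  assumes "l \<le> N"
  shows "(\<Sum>j=2..N+2. Z_mat N l j * cheb_dd x j) = poly (cheb l) x"
proof -
  consider "l = 0" | "l = 1" | "l = 2" | "l \<ge> 3" by linarith
  then show ?thesis
  proof cases
    case 1
    have "(\<Sum>j=2..N+2. Z_mat N l j * cheb_dd x j) = (\<Sum>j=2..N+2. if j = 2 then cheb_dd x 2 / 4 else 0)"
      using 1 by (intro sum.cong) (auto simp: Z_mat_def)
    then show ?thesis using 1 cheb_low(1)[of x] by simp
  next
    case 2
    have "(\<Sum>j=2..N+2. Z_mat N l j * cheb_dd x j) = (\<Sum>j=2..N+2. if j = 3 then cheb_dd x 3 / 24 else 0)"
      using 2 assms by (intro sum.cong) (auto simp: Z_mat_def)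
    then show ?thesis using 2 assms cheb_low(3)[of x] poly_pderiv_cheb_dd[of 2 x] by simp
  next
    case 3
    have "(\<Sum>j=2..N+2. Z_mat N l j * cheb_dd x j)
        = (\<Sum>j=2..N+2. (if j = 2 then - cheb_dd x 2 / 6 else 0) + (if j = 4 then cheb_dd x 4 / 48 else 0))"
      using 3 assms by (intro sum.cong) (auto simp: Z_mat_def)
    then have "(\<Sum>j=2..N+2. Z_mat N l j * cheb_dd x j) = - cheb_dd x 2 / 6 + cheb_dd x 4 / 48"
      using 3 assms by (simp add: sum.distrib)
    moreover have "poly (cheb 2) x = poly (pderiv (cheb 3)) x / 6 - poly (pderiv (cheb (Suc 0))) x / 2"
      using poly_cheb_pderiv[of 2 x] by simp
    moreover have "poly (pderiv (cheb 3)) x = cheb_dd x 4 / 8 - cheb_dd x 2 / 4"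
      using poly_pderiv_cheb_dd[of 3 x] by simp
    ultimately show ?thesis using 3 cheb_low(2)[of x] by (simp add: diff_divide_distrib)
  next
    case 4
    have "(\<Sum>j=2..N+2. Z_mat N l j * cheb_dd x j)
        = (\<Sum>j=2..N+2. (if j = l + 2 then cheb_dd x (l + 2) / (4 * (real l + 1) * (real l + 2)) else 0)
          + (if j = l then - cheb_dd x l / (2 * (real l - 1) * (real l + 1)) else 0)
          + (if j = l - 2 then cheb_dd x (l - 2) / (4 * (real l - 1) * (real l - 2)) else 0))"
      using 4 assms by (intro sum.cong) (auto simp: Z_mat_def)
    also have "\<dots> = cheb_dd x (l + 2) / (4 * (real l + 1) * (real l + 2))
        - cheb_dd x l / (2 * (real l - 1) * (real l + 1))
        + cheb_dd x (l - 2) / (4 * (real l - 1) * (real l - 2))"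
    proof (cases "l = 3")
      case False
      then have "l + 2 \<in> {2..N+2}" "l \<in> {2..N+2}" "l - 2 \<in> {2..N+2}" using 4 assms by auto
      then show ?thesis
        by (simp only: sum.distrib sum.delta finite_atLeastAtMost if_True)
    qed (use assms in \<open>simp add: sum.distrib\<close>)
    \<comment> \<open>Partial fractions split the middle entry \<open>1 / (2 (l - 1) (l + 1))\<close> into the two contributions
      of \<open>T_l''\<close> that come from \<open>T_{l+1}'\<close> and \<open>T_{l-1}'\<close>.\<close>
    also have "\<dots> = (cheb_dd x (l + 2) / (2 * (real l + 2)) - cheb_dd x l / (2 * real l)) / (2 * (real l + 1))
        - (cheb_dd x l / (2 * real l) - cheb_dd x (l - 2) / (2 * (real l - 2))) / (2 * (real l - 1))"
    proof -
      have "real l > 0" "real l - 1 > 0" "real l - 2 > 0" using 4 by auto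
      moreover have "a / (4 * (r + 1) * (r + 2)) - b / (2 * (r - 1) * (r + 1)) + c / (4 * (r - 1) * (r - 2))
        = (a / (2 * (r + 2)) - b / (2 * r)) / (2 * (r + 1)) - (b / (2 * r) - c / (2 * (r - 2))) / (2 * (r - 1))"
        if "r > 0" "r - 1 > 0" "r - 2 > 0" for a b c r :: real
      proof -
        have "b / (2 * (r - 1) * (r + 1)) = b / (2 * r) / (2 * (r + 1)) + b / (2 * r) / (2 * (r - 1))"
          using that by (simp add: divide_simps) (simp add: algebra_simps)
        moreover have "a / (4 * (r + 1) * (r + 2)) = a / (2 * (r + 2)) / (2 * (r + 1))"
          "c / (4 * (r - 1) * (r - 2)) = c / (2 * (r - 2)) / (2 * (r - 1))"
          by (simp_all add: algebra_simps)
        ultimately show ?thesis unfolding diff_divide_distrib by linarith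
      qed
      ultimately show ?thesis by blast
    qed
    also have "\<dots> = poly (cheb l) x"
    proof -
      have "l + 1 - 1 = l" "l - 1 + 1 = l" "l - 1 - 1 = l - 2" "l - 1 \<ge> 2" "l + 1 \<ge> 2"
        "real (l + 1) + 1 = real l + 2" "real (l + 1) - 1 = real l" "real (l - 1) + 1 = real l"
        "real (l - 1) - 1 = real l - 2" "l + 1 + 1 = l + 2"
        using 4 by auto
      then show ?thesis
        using 4 poly_cheb_pderiv[of l x] poly_pderiv_cheb_dd[of "l + 1" x] poly_pderiv_cheb_dd[of "l - 1" x]
        by simp
    qed
    finally show ?thesis .
  qed
qed

text \<open>Multiplying column \<open>j\<close> of the system by \<open>T_j''(x)\<close> and summing over \<open>j\<close> reassembles the Chebyshev
  sums, by the row expansions above.\<close>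

lemma coeff_system_ode:
  assumes "coeff_system N T \<omega> q v"
  shows "(\<Sum>l=1..N+1. of_real (cheb_dd x l) *s v l)
      + (2 * \<i> * of_real \<omega> * of_real T) *s (\<Sum>l=1..N+1. of_real (poly (pderiv (cheb l)) x) *s v l)
    = of_real (T\<^sup>2) *s (\<Sum>l=0..N. of_real (poly (cheb l) x) *s q l)"
proof (subst vec_eq_iff, rule allI)
  fix i
  define c where "c = 2 * \<i> * of_real \<omega> * complex_of_real T"
  define M where "M = (\<lambda>l j. c * of_real (A_mat N l j) + of_real (B_mat N l j))"
  let ?D = "\<lambda>j. complex_of_real (cheb_dd x j)" and ?J = "{2..N+2}" and ?L = "{1..N+1}"
  let ?T1 = "\<lambda>l. complex_of_real (poly (pderiv (cheb l)) x)"
  have r: "?D l + c * ?T1 l = (\<Sum>j\<in>?J. M l j * ?D j)" if "l \<in> ?L" for l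
  proof -
    have "(\<Sum>j\<in>?J. M l j * ?D j) = c * of_real (\<Sum>j\<in>?J. A_mat N l j * cheb_dd x j)
        + of_real (\<Sum>j\<in>?J. B_mat N l j * cheb_dd x j)"
      by (simp add: M_def distrib_right sum.distrib sum_distrib_left mult.assoc)
    then show ?thesis using that A_mat_sum[of l N x] B_mat_sum[of l N x] by (simp only: atLeastAtMost_iff add.commute)
  qed
  have "(\<Sum>l\<in>?L. ?D l * v l $ i) + c * (\<Sum>l\<in>?L. ?T1 l * v l $ i)
      = (\<Sum>l\<in>?L. (?D l + c * ?T1 l) * v l $ i)"
    by (simp add: sum_distrib_left distrib_right sum.distrib mult.assoc)
  also have "\<dots> = (\<Sum>l\<in>?L. \<Sum>j\<in>?J. ?D j * (M l j * v l $ i))"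
    by (intro sum.cong refl) (simp add: r sum_distrib_left sum_distrib_right mult_ac)
  also have "\<dots> = (\<Sum>j\<in>?J. ?D j * (\<Sum>l\<in>?L. M l j * v l $ i))"
    by (subst sum.swap) (simp add: sum_distrib_left)
  also have "\<dots> = (\<Sum>j\<in>?J. ?D j * (of_real (T\<^sup>2) * (\<Sum>l=0..N. of_real (Z_mat N l j) * q l $ i)))"
  proof (intro sum.cong refl)
    fix j assume "j \<in> ?J"
    with assms have "(\<Sum>l\<in>?L. M l j *s v l) = of_real (T\<^sup>2) *s (\<Sum>l=0..N. of_real (Z_mat N l j) *s q l)"
      unfolding coeff_system_def M_def c_def by blast
    then have "(\<Sum>l\<in>?L. M l j *s v l) $ i
        = (of_real (T\<^sup>2) *s (\<Sum>l=0..N. of_real (Z_mat N l j) *s q l)) $ i"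
      by (rule arg_cong)
    then show "?D j * (\<Sum>l\<in>?L. M l j * v l $ i)
        = ?D j * (of_real (T\<^sup>2) * (\<Sum>l=0..N. of_real (Z_mat N l j) * q l $ i))"
      by (simp only: sum_component vector_smult_component)
  qed
  also have "\<dots> = (\<Sum>j\<in>?J. \<Sum>l=0..N. of_real (T\<^sup>2) * (of_real (Z_mat N l j * cheb_dd x j) * q l $ i))"
    by (simp add: sum_distrib_left mult_ac)
  also have "\<dots> = (\<Sum>l=0..N. of_real (T\<^sup>2) * (of_real (\<Sum>j\<in>?J. Z_mat N l j * cheb_dd x j) * q l $ i))"
    by (subst sum.swap) (simp add: sum_distrib_left sum_distrib_right)
  also have "\<dots> = of_real (T\<^sup>2) * (\<Sum>l=0..N. of_real (poly (cheb l) x) * q l $ i)"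
    unfolding sum_distrib_left by (intro sum.cong refl) (simp only: Z_mat_sum atLeastAtMost_iff)
  finally show "((\<Sum>l=1..N+1. ?D l *s v l)
      + (2 * \<i> * of_real \<omega> * of_real T) *s (\<Sum>l=1..N+1. ?T1 l *s v l)) $ i
      = (of_real (T\<^sup>2) *s (\<Sum>l=0..N. of_real (poly (cheb l) x) *s q l)) $ i"
    by (simp only: sum_component vector_smult_component vector_add_component c_def)
qed

section \<open>Solvability of the coefficient equations\<close>

lemma triangular_sum:
  fixes a :: "nat \<Rightarrow> nat \<Rightarrow> complex" and v :: "nat \<Rightarrow> complex^'m"
  assumes "\<And>l. 1 \<le> l \<Longrightarrow> l < j \<Longrightarrow> a l j = 0" "j \<in> {1..n}"
  shows "(\<Sum>l=1..n. a l j *s v l) = a j j *s v j + (\<Sum>l=Suc j..n. a l j *s v l)"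
proof -
  have "(\<Sum>l=1..n. a l j *s v l) = (\<Sum>l=j..n. a l j *s v l)"
    using assms by (intro sum.mono_neutral_right) (auto simp: not_le)
  then show ?thesis using assms(2) by (simp add: sum.atLeast_Suc_atMost)
qed

text \<open>Back substitution: the equations are satisfied from the last one upwards, since changing the
  unknown with index \<open>j\<close> does not affect the equations with larger index.\<close>

lemma triangular_system_solvable:
  fixes a :: "nat \<Rightarrow> nat \<Rightarrow> complex" and b :: "nat \<Rightarrow> complex^'m"
  assumes d: "\<And>j. j \<in> {1..n} \<Longrightarrow> a j j \<noteq> 0"
    and z: "\<And>l j. 1 \<le> l \<Longrightarrow> l < j \<Longrightarrow> j \<le> n \<Longrightarrow> a l j = 0"
  shows "\<exists>v. \<forall>j\<in>{1..n}. (\<Sum>l=1..n. a l j *s v l) = b j"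
proof -
  have "\<exists>v. \<forall>j\<in>{m<..n}. (\<Sum>l=1..n. a l j *s v l) = b j" if "m \<le> n" for m
    using that
  proof (induction m rule: inc_induct)
    case base
    show ?case by simp
  next
    case (step m)
    then obtain v where v: "\<forall>j\<in>{Suc m<..n}. (\<Sum>l=1..n. a l j *s v l) = b j" by blast
    let ?j = "Suc m"
    let ?x = "inverse (a ?j ?j) *s (b ?j - (\<Sum>l=Suc ?j..n. a l ?j *s v l))"
    let ?v = "v(?j := ?x)"
    have "(\<Sum>l=1..n. a l j *s ?v l) = b j" if "j \<in> {m<..n}" for j
    proof -
      have t: "(\<Sum>l=1..n. a l j *s u l) = a j j *s u j + (\<Sum>l=Suc j..n. a l j *s u l)"
        for u :: "nat \<Rightarrow> complex^'m"
        using that z by (intro triangular_sum) auto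
      have s: "(\<Sum>l=Suc j..n. a l j *s ?v l) = (\<Sum>l=Suc j..n. a l j *s v l)"
        using that by (intro sum.cong) auto
      show ?thesis
      proof (cases "j = ?j")
        case True
        then show ?thesis using d[of ?j] that unfolding t s by (simp add: vec_eq_iff)
      next
        case False
        then have "a j j *s v j + (\<Sum>l=Suc j..n. a l j *s v l) = b j"
          using v that unfolding t[symmetric] by simp
        with False show ?thesis unfolding t s by simp
      qed
    qed
    then show ?case by blast
  qed
  from this[of 0] show ?thesis by (simp add: greaterThanAtMost_def atLeastAtMost_def greaterThan_def atLeast_def Suc_le_eq)
qed

lemma triangular_system_unique:
  fixes a :: "nat \<Rightarrow> nat \<Rightarrow> complex" and v w :: "nat \<Rightarrow> complex^'m"
  assumes d: "\<And>j. j \<in> {1..n} \<Longrightarrow> a j j \<noteq> 0"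
    and z: "\<And>l j. 1 \<le> l \<Longrightarrow> l < j \<Longrightarrow> j \<le> n \<Longrightarrow> a l j = 0"
    and eq: "\<And>j. j \<in> {1..n} \<Longrightarrow> (\<Sum>l=1..n. a l j *s v l) = (\<Sum>l=1..n. a l j *s w l)"
    and "j \<in> {1..n}"
  shows "v j = w j"
  using \<open>j \<in> {1..n}\<close>
proof (induction "n - j" arbitrary: j rule: less_induct)
  case less
  have t: "(\<Sum>l=1..n. a l j *s u l) = a j j *s u j + (\<Sum>l=Suc j..n. a l j *s u l)"
    for u :: "nat \<Rightarrow> complex^'m"
    using less.prems z by (intro triangular_sum) auto
  have "(\<Sum>l=Suc j..n. a l j *s v l) = (\<Sum>l=Suc j..n. a l j *s w l)"
    using less by (intro sum.cong) auto
  with eq[OF less.prems] d[OF less.prems] show ?case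
    unfolding t by (simp add: vec_eq_iff)
qed

text \<open>Shifting the column index by one puts the first superdiagonal of \<open>A\<close> on the diagonal, where \<open>B\<close>
  vanishes. The diagonal entries are then \<open>i\<omega>T / (j + 1)\<close>.\<close>

lemma coeff_system_matrix:
  assumes "T \<noteq> 0" "\<omega> \<noteq> 0" "a = (\<lambda>l j. 2 * \<i> * of_real \<omega> * of_real T * of_real (A_mat N l (Suc j))
                      + of_real (B_mat N l (Suc j)))"
  shows "\<And>j. j \<in> {1..N+1} \<Longrightarrow> a j j \<noteq> 0"
    and "\<And>l j. 1 \<le> l \<Longrightarrow> l < j \<Longrightarrow> j \<le> N+1 \<Longrightarrow> a l j = 0"
    and "coeff_system N T \<omega> q v \<longleftrightarrow> (\<forall>j\<in>{1..N+1}. (\<Sum>l=1..N+1. a l j *s v l)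
      = of_real (T\<^sup>2) *s (\<Sum>l=0..N. of_real (Z_mat N l (Suc j)) *s q l))"
proof -
  show "a j j \<noteq> 0" if "j \<in> {1..N+1}" for j
  proof -
    have AB: "A_mat N j (Suc j) = 1 / (2 * (real j + 1))" "B_mat N j (Suc j) = 0"
      using that by (auto simp: A_mat_def B_mat_def)
    have nz: "real j + 1 \<noteq> 0" by linarith
    have "a j j = \<i> * of_real \<omega> * of_real T / of_real (real j + 1)"
      using nz unfolding assms(3) AB of_real_divide of_real_mult by (simp add: field_simps del: of_real_add)
    then show ?thesis using assms(1,2) nz by (metis complex_i_not_zero divide_eq_0_iff mult_eq_0_iff of_real_eq_0_iff)
  qed
  show "a l j = 0" if "1 \<le> l" "l < j" "j \<le> N+1" for l j
    using that assms(3) by (simp add: A_mat_def B_mat_def)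
  have S: "(\<forall>j\<in>{2..N+2}. P j) \<longleftrightarrow> (\<forall>j\<in>{1..N+1}. P (Suc j))" for P
    using image_Suc_atLeastAtMost[of 1 "N+1"] by (metis (no_types, lifting) Suc_1 add_2_eq_Suc' add.commute plus_1_eq_Suc image_iff)
  show "coeff_system N T \<omega> q v \<longleftrightarrow> (\<forall>j\<in>{1..N+1}. (\<Sum>l=1..N+1. a l j *s v l)
      = of_real (T\<^sup>2) *s (\<Sum>l=0..N. of_real (Z_mat N l (Suc j)) *s q l))"
    unfolding coeff_system_def S assms(3) ..
qed

section \<open>Oscillating Chebyshev sums\<close>

definition poly_comb ::
  "(nat \<Rightarrow> real poly) \<Rightarrow> real \<Rightarrow> nat \<Rightarrow> (nat \<Rightarrow> complex^'m) \<Rightarrow> real \<Rightarrow> complex^'m::finite" where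
  "poly_comb p T L c \<theta> = (\<Sum>l=0..L. of_real (poly (p l) (\<theta> / T)) *s c l)"

lemma has_vector_derivative_poly_comb:
  "(poly_comb p T L c has_vector_derivative
     of_real (1 / T) *s poly_comb (\<lambda>l. pderiv (p l)) T L c \<theta>) (at \<theta> within S)"
proof -
  have "((\<lambda>\<theta>. of_real (poly (p l) (\<theta> / T)) *s c l) has_vector_derivative
      of_real (poly (pderiv (p l)) (\<theta> / T) / T) *s c l) (at \<theta> within S)" for l
  proof -
    have "((\<lambda>\<theta>. poly (p l) (\<theta> / T)) has_real_derivative poly (pderiv (p l)) (\<theta> / T) / T)
        (at \<theta> within S)"
      using DERIV_chain2[OF poly_DERIV DERIV_cdivide[OF DERIV_ident]] by simp
    then have "((\<lambda>\<theta>. complex_of_real (poly (p l) (\<theta> / T))) has_vector_derivative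
        of_real (poly (pderiv (p l)) (\<theta> / T) / T)) (at \<theta> within S)"
      by (rule has_vector_derivative_of_real)
    from bounded_linear.has_vector_derivative[OF
        bounded_bilinear.bounded_linear_left[OF bounded_bilinear_vector_scalar_mult] this]
    show ?thesis .
  qed
  then have "(poly_comb p T L c has_vector_derivative
      (\<Sum>l=0..L. of_real (poly (pderiv (p l)) (\<theta> / T) / T) *s c l)) (at \<theta> within S)"
    unfolding poly_comb_def [abs_def] by (intro has_vector_derivative_sum)
  also have "(\<Sum>l=0..L. of_real (poly (pderiv (p l)) (\<theta> / T) / T) *s c l)
      = of_real (1 / T) *s poly_comb (\<lambda>l. pderiv (p l)) T L c \<theta>"
    by (simp add: poly_comb_def vec_eq_iff sum_distrib_left)
  finally show ?thesis .
qed

lemma cheb_osc_eq: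
  "cheb_osc L T \<omega> c = restrict (\<lambda>\<theta>.
      exp (\<i> * of_real \<omega> * of_real \<theta>) *s poly_comb cheb T L c \<theta>
    + vcnj (exp (\<i> * of_real \<omega> * of_real \<theta>) *s poly_comb cheb T L c \<theta>)) {-T..T}"
  unfolding cheb_osc_def poly_comb_def
  by (simp add: vcnj_sum exp_cnj mult.assoc)

text \<open>The equation \<open>P'' + 2 i\<omega> P' = Q\<close> in the scaled variable; each derivative brings a factor \<open>1 / T\<close>,
  which accounts for the factor \<open>T\<^sup>2\<close> in the coefficient system.\<close>

lemma poly_comb_ode:
  assumes "T \<noteq> 0" "coeff_system N T \<omega> q v"
  shows "of_real (1 / T) *s (of_real (1 / T) *s poly_comb (\<lambda>l. pderiv (pderiv (cheb l))) T (N + 1) v \<theta>)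
      + (2 * (\<i> * of_real \<omega>)) *s (of_real (1 / T) *s poly_comb (\<lambda>l. pderiv (cheb l)) T (N + 1) v \<theta>)
    = poly_comb cheb T N q \<theta>"
proof -
  let ?P2 = "poly_comb (\<lambda>l. pderiv (pderiv (cheb l))) T (N + 1) v \<theta>"
  let ?P1 = "poly_comb (\<lambda>l. pderiv (cheb l)) T (N + 1) v \<theta>"
  have sums: "?P2 = (\<Sum>l=1..N+1. of_real (cheb_dd (\<theta> / T) l) *s v l)"
    "?P1 = (\<Sum>l=1..N+1. of_real (poly (pderiv (cheb l)) (\<theta> / T)) *s v l)"
    by (simp_all add: poly_comb_def cheb_dd_def sum.atLeast_Suc_atMost cheb.simps(1) pderiv_1)
  have "?P2 + (2 * \<i> * of_real \<omega> * of_real T) *s ?P1 = of_real (T\<^sup>2) *s poly_comb cheb T N q \<theta>"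
    unfolding sums unfolding poly_comb_def by (rule coeff_system_ode[OF assms(2)])
  then have "of_real (1 / T\<^sup>2) *s (?P2 + (2 * \<i> * of_real \<omega> * of_real T) *s ?P1)
      = of_real (1 / T\<^sup>2) *s (of_real (T\<^sup>2) *s poly_comb cheb T N q \<theta>)" by (rule arg_cong)
  moreover have "complex_of_real (1 / T\<^sup>2) * (2 * \<i> * of_real \<omega> * of_real T)
      = 2 * (\<i> * of_real \<omega>) * of_real (1 / T)"
    "complex_of_real (1 / T\<^sup>2) = of_real (1 / T) * of_real (1 / T)"
    "complex_of_real (1 / T\<^sup>2) * of_real (T\<^sup>2) = 1"
    using assms(1) by (simp_all add: power2_eq_square)
  ultimately show ?thesis
    by (simp only: vec.scale_right_distrib vector_smult_assoc vec.scale_one)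
qed

lemma vRe_simps:
  "vRe (x + y) = vRe x + vRe y" "vRe (of_real r *s x) = of_real r *s vRe x"
  "2 *s vRe x = x + vcnj x"
  by (simp_all add: vRe_def vcnj_def vec_eq_iff complex_add_cnj)

lemma vRe_sum: "vRe (\<Sum>a\<in>S. f a) = (\<Sum>a\<in>S. vRe (f a))"
  by (simp add: vRe_def vec_eq_iff)

lemma vector_scalar_sum_right: "c *s (\<Sum>a\<in>S. f a) = (\<Sum>a\<in>S. (c::complex) *s f a)"
  by (simp add: vec_eq_iff sum_distrib_left)

text \<open>With \<open>F = exp (z \<theta>) P\<close> the right-hand side is half of \<open>\<phi>' + z \<phi>\<close> for \<open>\<phi> = F + cnj F\<close>. The left-hand
  side isolates the contribution of \<open>v 0\<close>, which has no real-part term because \<open>T_0' = 0\<close>.\<close>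

lemma v0_sum_eq:
  fixes v :: "nat \<Rightarrow> complex^'m::finite" and \<omega> :: real
  defines "z \<equiv> \<i> * complex_of_real \<omega>"
  shows "v0_sum N T \<omega> v \<theta> + z *s (exp (z * of_real \<theta>) *s v 0)
    = vRe (exp (z * of_real \<theta>) *s (of_real (1 / T) *s poly_comb (\<lambda>l. pderiv (cheb l)) T (N + 1) v \<theta>))
      + z *s (exp (z * of_real \<theta>) *s poly_comb cheb T (N + 1) v \<theta>)"
proof -
  let ?e = "exp (z * of_real \<theta>)"
  have "vRe (?e *s (of_real (1 / T) *s poly_comb (\<lambda>l. pderiv (cheb l)) T (N + 1) v \<theta>))
      = (\<Sum>l=1..N+1. of_real (poly (pderiv (cheb l)) (\<theta> / T) / T) *s vRe (?e *s v l))"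
  proof -
    have "?e *s (of_real (1 / T) *s poly_comb (\<lambda>l. pderiv (cheb l)) T (N + 1) v \<theta>)
        = (\<Sum>l=1..N+1. of_real (poly (pderiv (cheb l)) (\<theta> / T) / T) *s (?e *s v l))"
      unfolding poly_comb_def vector_scalar_sum_right
      by (simp add: sum.atLeast_Suc_atMost cheb.simps(1) pderiv_1 mult_ac)
    then show ?thesis by (simp only: vRe_sum vRe_simps)
  qed
  moreover have "z *s (?e *s poly_comb cheb T (N + 1) v \<theta>)
      = z *s (?e *s v 0) + (\<Sum>l=1..N+1. (z * of_real (poly (cheb l) (\<theta> / T)) * ?e) *s v l)"
    unfolding poly_comb_def vector_scalar_sum_right
    by (simp add: sum.atLeast_Suc_atMost cheb.simps(1) mult_ac)
  ultimately show ?thesis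
    by (simp add: v0_sum_def z_def sum.distrib mult.assoc)
qed

section \<open>The boundary conditions\<close>

text \<open>The linear system for \<open>v 0\<close>, rearranged so that it applies the delay functional to the known part
  of \<open>(\<phi>' + z \<phi>) / 2\<close>.\<close>

lemma v0_system_iff:
  "v0_system H \<tau> K N \<omega> q v \<longleftrightarrow>
    (\<i> * of_real \<omega>) *s (char_mat H \<tau> K (\<i> * of_real \<omega>) *v v 0)
      + (\<i> * of_real \<omega>) *s v0_sum N (\<tau> K) \<omega> v 0 + vRe (poly_comb cheb (\<tau> K) N q 0)
    = delay_rhs H \<tau> K (v0_sum N (\<tau> K) \<omega> v)"
proof -
  let ?z = "\<i> * complex_of_real \<omega>"
  have 0: "v0_sum N (\<tau> K) \<omega> v 0 = (\<Sum>l=1..N+1. of_real (poly (pderiv (cheb l)) 0 / \<tau> K) *s vRe (v l)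
                     + (\<i> * of_real \<omega> * of_real (poly (cheb l) 0)) *s v l)"
    by (simp add: v0_sum_def)
  have q: "vRe (poly_comb cheb (\<tau> K) N q 0) = (\<Sum>l=0..N. of_real (poly (cheb l) 0) *s vRe (q l))"
    by (simp add: poly_comb_def vRe_sum vRe_simps)
  show ?thesis
    unfolding v0_system_def 0[symmetric] q[symmetric] delay_rhs_def matrix_vector_mult_diff_rdistrib mat_vector_mult
    by (auto simp: algebra_simps)
qed

text \<open>Comparing real and imaginary parts separates the two boundary conditions again.\<close>

lemma vcnj_fixed_split:
  assumes "b + (\<i> * of_real \<omega>) *s a = b' + (\<i> * of_real \<omega>) *s a'" "\<omega> \<noteq> 0"
    and "vcnj a = a" "vcnj a' = a'" "vcnj b = b" "vcnj b' = b'"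
  shows "a = a'" "b = b'"
proof -
  let ?z = "\<i> * complex_of_real \<omega>"
  have eq: "b - ?z *s a = b' - ?z *s a'"
    using arg_cong[OF assms(1), of vcnj] assms(3-) by (simp add: vec_eq_iff)
  have "2 *s y = (y + ?z *s x) + (y - ?z *s x)" "(2 * ?z) *s x = (y + ?z *s x) - (y - ?z *s x)"
    for x y :: "complex^'a"
    by (simp_all add: vec_eq_iff)
  then have "2 *s b = 2 *s b'" "(2 * ?z) *s a = (2 * ?z) *s a'"
    by (metis assms(1) eq)+
  with assms(2) show "a = a'" "b = b'" by (simp_all add: vec_eq_iff)
qed

context delay_operator
begin

lemma R_dom_restrict:
  fixes f f' f'' :: "real \<Rightarrow> complex^'m"
  assumes "\<And>\<theta> S. (f has_vector_derivative f' \<theta>) (at \<theta> within S)"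
    and "\<And>\<theta> S. (f' has_vector_derivative f'' \<theta>) (at \<theta> within S)"
    and "continuous_on {-\<tau> K..\<tau> K} f''"
    and "f' 0 = delay_rhs H \<tau> K f" "f'' 0 = delay_rhs H \<tau> K f'"
  shows "restrict f {-\<tau> K..\<tau> K} \<in> R_dom H \<tau> K"
    and "R_op (\<tau> K) \<sigma> (restrict f {-\<tau> K..\<tau> K}) = restrict (\<lambda>\<theta>. f'' \<theta> - \<sigma>\<^sup>2 *s f \<theta>) {-\<tau> K..\<tau> K}"
proof -
  have "continuous_on {-\<tau> K..\<tau> K} f'"
    using has_vector_derivative_continuous assms(2) continuous_on_eq_continuous_within by blast
  note 1 = ham_dom_restrict[OF this assms(1,4)] and 2 = ham_dom_restrict[OF assms(3,2,5)]
  show "restrict f {-\<tau> K..\<tau> K} \<in> R_dom H \<tau> K"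
    "R_op (\<tau> K) \<sigma> (restrict f {-\<tau> K..\<tau> K}) = restrict (\<lambda>\<theta>. f'' \<theta> - \<sigma>\<^sup>2 *s f \<theta>) {-\<tau> K..\<tau> K}"
    using 1 2 by (auto simp: R_dom_def ham_dom_def R_op_def intro!: restrict_ext)
qed

text \<open>The function \<open>g\<close> in the proof is half of \<open>\<Phi>' + z \<Phi>\<close>. The boundary condition for \<open>g\<close> is free of its
  derivative: the differential equation at 0 gives \<open>g' = z g + Re Q\<close> there, which is how the real
  parts of \<open>q\<close> enter the system for \<open>v 0\<close>.\<close>

lemma R_op_cheb_osc:
  fixes q v :: "nat \<Rightarrow> complex^'m"
  assumes "\<omega> \<noteq> 0" "coeff_system N (\<tau> K) \<omega> q v" "v0_system H \<tau> K N \<omega> q v"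
  shows "cheb_osc (N + 1) (\<tau> K) \<omega> v \<in> R_dom H \<tau> K"
    and "R_op (\<tau> K) (\<i> * of_real \<omega>) (cheb_osc (N + 1) (\<tau> K) \<omega> v) = cheb_osc N (\<tau> K) \<omega> q"
proof -
  define z where "z = \<i> * complex_of_real \<omega>"
  define e where "e = (\<lambda>\<theta>. exp (z * complex_of_real \<theta>))"
  define P where "P = poly_comb cheb (\<tau> K) (N + 1) v"
  define P' where "P' = (\<lambda>\<theta>. of_real (1 / \<tau> K) *s poly_comb (\<lambda>l. pderiv (cheb l)) (\<tau> K) (N + 1) v \<theta>)"
  define P'' where "P'' = (\<lambda>\<theta>. of_real (1 / \<tau> K) *s (of_real (1 / \<tau> K) *s
      poly_comb (\<lambda>l. pderiv (pderiv (cheb l))) (\<tau> K) (N + 1) v \<theta>))"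
  define Q where "Q = poly_comb cheb (\<tau> K) N q"
  define F where "F = (\<lambda>\<theta>. e \<theta> *s P \<theta>)"
  define F' where "F' = (\<lambda>\<theta>. e \<theta> *s (P' \<theta> + z *s P \<theta>))"
  define F'' where "F'' = (\<lambda>\<theta>. e \<theta> *s Q \<theta> + z\<^sup>2 *s F \<theta>)"
  define \<Phi> where "\<Phi> = (\<lambda>\<theta>. F \<theta> + vcnj (F \<theta>))"
  define \<Phi>' where "\<Phi>' = (\<lambda>\<theta>. F' \<theta> + vcnj (F' \<theta>))"
  define \<Phi>'' where "\<Phi>'' = (\<lambda>\<theta>. F'' \<theta> + vcnj (F'' \<theta>))"
  define g where "g = (\<lambda>\<theta>. v0_sum N (\<tau> K) \<omega> v \<theta> + z *s (e \<theta> *s v 0))"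
  have z: "cnj z = - z" by (simp add: z_def)
  have dP: "(P has_vector_derivative P' \<theta>) (at \<theta> within S)" for \<theta> S
    unfolding P_def P'_def by (rule has_vector_derivative_poly_comb)
  have dP': "(P' has_vector_derivative P'' \<theta>) (at \<theta> within S)" for \<theta> S
    unfolding P'_def P''_def
    by (rule bounded_linear.has_vector_derivative[OF bounded_linear_vector_scalar_mult
          has_vector_derivative_poly_comb])
  have dQ: "continuous_on S Q" for S
    unfolding Q_def continuous_on_eq_continuous_within
    using has_vector_derivative_continuous has_vector_derivative_poly_comb by blast
  have dF: "(F has_vector_derivative F' \<theta>) (at \<theta> within S)" for \<theta> S
    unfolding F_def F'_def e_def by (rule has_vector_derivative_cexp_scale[OF dP])
  have ode: "P'' \<theta> + (2 * z) *s P' \<theta> = Q \<theta>" for \<theta>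
    unfolding P'_def P''_def Q_def z_def using poly_comb_ode[OF _ assms(2)] horizon_pos by simp
  have dF': "(F' has_vector_derivative F'' \<theta>) (at \<theta> within S)" for \<theta> S
  proof -
    have "((\<lambda>\<theta>. P' \<theta> + z *s P \<theta>) has_vector_derivative P'' \<theta> + z *s P' \<theta>) (at \<theta> within S)"
      by (intro has_vector_derivative_add dP' dP
          bounded_linear.has_vector_derivative[OF bounded_linear_vector_scalar_mult])
    from has_vector_derivative_cexp_scale[OF this, of z]
    have "(F' has_vector_derivative e \<theta> *s (P'' \<theta> + z *s P' \<theta> + z *s (P' \<theta> + z *s P \<theta>))) (at \<theta> within S)"
      unfolding F'_def e_def .
    moreover have "e \<theta> *s (P'' \<theta> + z *s P' \<theta> + z *s (P' \<theta> + z *s P \<theta>)) = F'' \<theta>"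
      unfolding F''_def F_def ode[symmetric] by (simp add: vec_eq_iff algebra_simps power2_eq_square)
    ultimately show ?thesis by simp
  qed
  have d: "(\<Phi> has_vector_derivative \<Phi>' \<theta>) (at \<theta> within S)"
    "(\<Phi>' has_vector_derivative \<Phi>'' \<theta>) (at \<theta> within S)" for \<theta> S
    unfolding \<Phi>_def \<Phi>'_def \<Phi>''_def
    by (intro has_vector_derivative_add dF dF' bounded_linear.has_vector_derivative[OF bounded_linear_vcnj])+
  have "continuous_on S F" for S
    using has_vector_derivative_continuous dF continuous_on_eq_continuous_within by blast
  then have cont: "continuous_on S \<Phi>''" for S
    unfolding \<Phi>''_def F''_def e_def
    by (intro continuous_on_add dQ bounded_linear.continuous_on[OF bounded_linear_vcnj]
        bounded_linear.continuous_on[OF bounded_linear_vector_scalar_mult]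
        bounded_bilinear.continuous_on[OF bounded_bilinear_vector_scalar_mult] continuous_intros)
  have g: "\<Phi>' \<theta> + z *s \<Phi> \<theta> = 2 *s g \<theta>" for \<theta>
  proof -
    have "g \<theta> = vRe (e \<theta> *s P' \<theta>) + z *s F \<theta>"
      unfolding g_def F_def P'_def P_def e_def z_def by (rule v0_sum_eq)
    then have "2 *s g \<theta> = e \<theta> *s P' \<theta> + vcnj (e \<theta> *s P' \<theta>) + 2 *s (z *s F \<theta>)"
      by (simp only: vec.scale_right_distrib vRe_simps)
    moreover have "F' \<theta> = e \<theta> *s P' \<theta> + z *s F \<theta>"
      by (simp add: F'_def F_def vec_eq_iff algebra_simps)
    ultimately show ?thesis
      by (simp add: \<Phi>'_def \<Phi>_def z) (simp add: vec_eq_iff algebra_simps)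
  qed
  have rhs: "z *s g 0 + vRe (Q 0) = delay_rhs H \<tau> K g"
  proof -
    have dg: "delay_rhs H \<tau> K g = delay_rhs H \<tau> K (v0_sum N (\<tau> K) \<omega> v) + z *s (z *s v 0 - char_mat H \<tau> K z *v v 0)"
      unfolding g_def delay_rhs_add delay_rhs_scale char_mat_mult e_def by simp
    have g0: "g 0 = v0_sum N (\<tau> K) \<omega> v 0 + z *s v 0" by (simp add: g_def e_def)
    note v0 = assms(3)[unfolded v0_system_iff, folded z_def Q_def]
    show ?thesis unfolding dg g0 v0[symmetric] by (simp add: vec_eq_iff algebra_simps)
  qed
  have \<Phi>'': "\<Phi>'' \<theta> = (e \<theta> *s Q \<theta> + vcnj (e \<theta> *s Q \<theta>)) + z\<^sup>2 *s \<Phi> \<theta>" for \<theta>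
    unfolding \<Phi>''_def F''_def \<Phi>_def vcnj_simps by (simp add: z vec_eq_iff algebra_simps)
  have "\<Phi>'' 0 + z *s \<Phi>' 0 = z *s (\<Phi>' 0 + z *s \<Phi> 0) + 2 *s vRe (Q 0)"
    unfolding \<Phi>'' vRe_simps by (simp add: e_def) (simp add: vec_eq_iff algebra_simps power2_eq_square)
  also have "\<dots> = 2 *s delay_rhs H \<tau> K g"
    unfolding g rhs[symmetric] by (simp add: vec_eq_iff algebra_simps)
  also have "\<dots> = delay_rhs H \<tau> K (\<lambda>\<theta>. \<Phi>' \<theta> + z *s \<Phi> \<theta>)"
    unfolding g delay_rhs_scale ..
  also have "\<dots> = delay_rhs H \<tau> K \<Phi>' + z *s delay_rhs H \<tau> K \<Phi>"
    by (simp only: delay_rhs_add delay_rhs_scale)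
  finally have bc: "\<Phi>'' 0 + z *s \<Phi>' 0 = delay_rhs H \<tau> K \<Phi>' + z *s delay_rhs H \<tau> K \<Phi>" .
  have fixed: "vcnj (\<Phi> \<theta>) = \<Phi> \<theta>" "vcnj (\<Phi>' \<theta>) = \<Phi>' \<theta>" "vcnj (\<Phi>'' \<theta>) = \<Phi>'' \<theta>" for \<theta>
    by (simp_all add: \<Phi>_def \<Phi>'_def \<Phi>''_def add.commute)
  have "vcnj (delay_rhs H \<tau> K \<Phi>) = delay_rhs H \<tau> K \<Phi>" "vcnj (delay_rhs H \<tau> K \<Phi>') = delay_rhs H \<tau> K \<Phi>'"
    by (simp_all add: delay_rhs_vcnj[symmetric] fixed)
  note bcs = vcnj_fixed_split[OF bc[unfolded z_def] assms(1) fixed(2) this(1) fixed(3) this(2)]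
  have osc: "cheb_osc (N + 1) (\<tau> K) \<omega> v = restrict \<Phi> {-\<tau> K..\<tau> K}"
    unfolding cheb_osc_eq \<Phi>_def F_def P_def e_def z_def ..
  show "cheb_osc (N + 1) (\<tau> K) \<omega> v \<in> R_dom H \<tau> K"
    unfolding osc by (rule R_dom_restrict(1)[OF d cont bcs])
  have "R_op (\<tau> K) z (restrict \<Phi> {-\<tau> K..\<tau> K})
      = restrict (\<lambda>\<theta>. e \<theta> *s Q \<theta> + vcnj (e \<theta> *s Q \<theta>)) {-\<tau> K..\<tau> K}"
    unfolding R_dom_restrict(2)[OF d cont bcs] \<Phi>'' by simp
  also have "\<dots> = cheb_osc N (\<tau> K) \<omega> q"
    unfolding cheb_osc_eq Q_def e_def z_def ..
  finally show "R_op (\<tau> K) (\<i> * of_real \<omega>) (cheb_osc (N + 1) (\<tau> K) \<omega> v) = cheb_osc N (\<tau> K) \<omega> q"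
    unfolding osc z_def .
qed

text \<open>The coefficients with positive index solve a triangular system on their own; the equation for the
  remaining one has them in its right-hand side only and an invertible matrix on the left.\<close>

lemma coefficients_unique_existence:
  fixes q :: "nat \<Rightarrow> complex^'m"
  assumes "\<omega> \<noteq> 0" "\<not> ham_eigenvalue H \<tau> K (\<i> * of_real \<omega>)"
  shows "\<exists>!v. v \<in> extensional {0..N+1} \<and> coeff_system N (\<tau> K) \<omega> q v \<and> v0_system H \<tau> K N \<omega> q v"
proof -
  define z where "z = \<i> * complex_of_real \<omega>"
  define a where "a = (\<lambda>l j. 2 * \<i> * of_real \<omega> * of_real (\<tau> K) * of_real (A_mat N l (Suc j))
                      + complex_of_real (B_mat N l (Suc j)))"
  have "\<tau> K \<noteq> 0" using horizon_pos by simp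
  note a = coeff_system_matrix[OF this assms(1) a_def]
  note M = char_mat_bij[OF assms(2), folded z_def]
  define r where "r = (\<lambda>v. inverse z *s (delay_rhs H \<tau> K (v0_sum N (\<tau> K) \<omega> v)
      - z *s v0_sum N (\<tau> K) \<omega> v 0 - vRe (poly_comb cheb (\<tau> K) N q 0)))"
  have "z \<noteq> 0" using assms(1) by (simp add: z_def)
  then have scale: "z *s x = y \<longleftrightarrow> x = inverse z *s y" for x y :: "complex^'m"
    by (auto simp: vector_smult_assoc)
  have v0: "v0_system H \<tau> K N \<omega> q v \<longleftrightarrow> char_mat H \<tau> K z *v v 0 = r v" for v
  proof -
    have "v0_system H \<tau> K N \<omega> q v \<longleftrightarrow> z *s (char_mat H \<tau> K z *v v 0)
        = delay_rhs H \<tau> K (v0_sum N (\<tau> K) \<omega> v) - z *s v0_sum N (\<tau> K) \<omega> v 0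
          - vRe (poly_comb cheb (\<tau> K) N q 0)"
      unfolding v0_system_iff z_def[symmetric] by (simp only: eq_diff_eq)
        (simp only: add.commute add.left_commute)
    then show ?thesis unfolding r_def scale .
  qed
  have r_cong: "r v = r w" if "\<And>l. l \<in> {1..N+1} \<Longrightarrow> v l = w l" for v w
  proof -
    have "v0_sum N (\<tau> K) \<omega> v = v0_sum N (\<tau> K) \<omega> w"
      unfolding v0_sum_def by (intro ext sum.cong refl) (simp add: that)
    then show ?thesis by (simp add: r_def)
  qed
  show ?thesis
  proof (rule ex_ex1I)
    let ?b = "\<lambda>j. of_real ((\<tau> K)\<^sup>2) *s (\<Sum>l=0..N. of_real (Z_mat N l (Suc j)) *s q l)"
    have "\<exists>u. \<forall>j\<in>{1..N+1}. (\<Sum>l=1..N+1. a l j *s u l) = ?b j"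
      by (rule triangular_system_solvable[OF a(1,2)])
    then obtain u where u: "\<forall>j\<in>{1..N+1}. (\<Sum>l=1..N+1. a l j *s u l) = ?b j" ..
    obtain c where c: "r u = char_mat H \<tau> K z *v c" by (rule surjE[OF bij_is_surj[OF M]])
    define v where "v = restrict (u(0 := c)) {0..N+1}"
    have vu: "v l = u l" if "l \<in> {1..N+1}" for l using that by (simp add: v_def)
    have "coeff_system N (\<tau> K) \<omega> q v"
      unfolding a(3) using u by (simp add: vu)
    moreover have "v0_system H \<tau> K N \<omega> q v"
    proof -
      have "r v = r u" by (rule r_cong[OF vu])
      moreover have "v 0 = c" by (simp add: v_def)
      ultimately show ?thesis unfolding v0 using c by simp
    qed
    ultimately show "\<exists>v. v \<in> extensional {0..N+1} \<and> coeff_system N (\<tau> K) \<omega> q v \<and> v0_system H \<tau> K N \<omega> q v"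
      by (intro exI[of _ v]) (simp add: v_def)
  next
    fix v w :: "nat \<Rightarrow> complex^'m"
    assume v: "v \<in> extensional {0..N+1} \<and> coeff_system N (\<tau> K) \<omega> q v \<and> v0_system H \<tau> K N \<omega> q v"
      and w: "w \<in> extensional {0..N+1} \<and> coeff_system N (\<tau> K) \<omega> q w \<and> v0_system H \<tau> K N \<omega> q w"
    have eq: "v l = w l" if "l \<in> {1..N+1}" for l
    proof (rule triangular_system_unique[of "N + 1" a, OF a(1,2) _ that])
      show "(\<Sum>l=1..N+1. a l j *s v l) = (\<Sum>l=1..N+1. a l j *s w l)" if "j \<in> {1..N+1}" for j
        using v w that unfolding a(3) by simp
    qed
    have "char_mat H \<tau> K z *v v 0 = char_mat H \<tau> K z *v w 0"
      using v w r_cong[OF eq] by (simp add: v0)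
    then have "v 0 = w 0" using bij_is_inj[OF M] by (simp add: inj_eq)
    show "v = w"
    proof (rule extensionalityI[of v "{0..N+1}"])
      show "v l = w l" if "l \<in> {0..N+1}" for l
        using that eq[of l] \<open>v 0 = w 0\<close> by (cases l) auto
    qed (use v w in auto)
  qed
qed

end

section \<open>The inverse applied to an oscillating Chebyshev sum\<close>

theorem theorem5p1:
  fixes H :: "int \<Rightarrow> real^('n::finite + 'n)^('n + 'n)"
    and \<tau> :: "nat \<Rightarrow> real" and K N :: nat and \<omega> :: real
    and q :: "nat \<Rightarrow> complex^('n + 'n)"
  assumes "K \<ge> 1" and "0 < \<tau> 1" and "strict_mono_on {1..K} \<tau>"
    and "transpose (sympJ ** H 0) = sympJ ** H 0"
    and "\<And>k. k \<in> {1..K} \<Longrightarrow> transpose (sympJ ** H (- int k)) = sympJ ** H (int k)"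
    and "\<omega> \<noteq> 0" and "\<not> ham_eigenvalue H \<tau> K (\<i> * of_real \<omega>)"
  shows
    "bij_betw (R_op (\<tau> K) (\<i> * of_real \<omega>)) (R_dom H \<tau> K) (C_space (\<tau> K)) \<and>
     (\<exists>!v. v \<in> extensional {0..N+1} \<and> coeff_system N (\<tau> K) \<omega> q v \<and> v0_system H \<tau> K N \<omega> q v) \<and>
     (\<forall>v. coeff_system N (\<tau> K) \<omega> q v \<and> v0_system H \<tau> K N \<omega> q v \<longrightarrow>
        the_inv_into (R_dom H \<tau> K) (R_op (\<tau> K) (\<i> * of_real \<omega>)) (cheb_osc N (\<tau> K) \<omega> q)
          = cheb_osc (N + 1) (\<tau> K) \<omega> v)"
proof -
  have mono: "\<tau> i \<le> \<tau> j" if "1 \<le> i" "i \<le> j" "j \<le> K" for i j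
    using strict_mono_onD[OF assms(3), of i j] that by (cases "i = j") auto
  interpret delay_operator H \<tau> K
    using mono[of 1] mono[of _ K] assms(1,2) by unfold_locales (fastforce+)
  have "\<not> ham_eigenvalue H \<tau> K (- (\<i> * of_real \<omega>))"
    using ham_eigenvalue_cnj[of "- (\<i> * of_real \<omega>)"] assms(7) by auto
  note bij = R_op_bij[OF assms(7) this]
  show ?thesis
  proof (intro conjI allI impI bij coefficients_unique_existence assms(6,7))
    fix v :: "nat \<Rightarrow> complex^('n + 'n)"
    assume "coeff_system N (\<tau> K) \<omega> q v \<and> v0_system H \<tau> K N \<omega> q v"
    then show "the_inv_into (R_dom H \<tau> K) (R_op (\<tau> K) (\<i> * of_real \<omega>)) (cheb_osc N (\<tau> K) \<omega> q)
        = cheb_osc (N + 1) (\<tau> K) \<omega> v"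
      using R_op_cheb_osc assms(6) bij_betw_imp_inj_on[OF bij] by (intro the_inv_into_f_eq) blast+
  qed
qed

end
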